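(* Let $d,N_1,N_2,M\in\mathbb{N}$, $\ell\in\mathbb{N}_0$, $S>0$, $\gamma\in[0,1]$, $\theta\in(0,1]$. For $x^{(1)}\in(\mathbb{R}^d)^{N_1}$ and $x^{(2)}\in(\mathbb{R}^d)^{N_2}$ put $$T_\ell(x^{(1)},x^{(2)})=\Delta_\ell\left(\mathcal{D}_\ell(x^{(1)}),\mathcal{D}_\ell(x^{(2)})\right),$$ where $\mathcal{D}_\ell$ is the degree-$\ell$ Vietoris--Rips persistence diagram and $\Delta_\ell$ is the PL+JS statistic with parameters $M,S,\gamma,\theta$. Equip $(\mathbb{R}^d)^{N_1}\times(\mathbb{R}^d)^{N_2}$ with $$d_\ast\left((x^{(1)},x^{(2)}),(\tilde x^{(1)},\tilde x^{(2)})\right):=d_H^{(N_1)}(x^{(1)},\tilde x^{(1)})+d_H^{(N_2)}(x^{(2)},\tilde x^{(2)}),$$ where $$d_H^{(N)}(x,\tilde x):=\max\left\{\max_{1\le i\le N}\min_{1\le j\le N}\|x_i-\tilde x_j\|,\ \max_{1\le j\le N}\min_{1\le i\le N}\|x_i-\tilde x_j\|\right\}.$$ Then $T_\ell$ is $1/2$-Hölder continuous with respect to $d_\ast$: for all $x^{(1)},\tilde x^{(1)}\in(\mathbb{R}^d)^{N_1}$ and $x^{(2)},\tilde x^{(2)}\in(\mathbb{R}^d)^{N_2}$ such that every finite pair $(b,d)$ of each of the four diagrams $\mathcal{D}_\ell(x^{(1)}),\mathcal{D}_\ell(\tilde x^{(1)}),\mathcal{D}_\ell(x^{(2)}),\mathcal{D}_\ell(\tilde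 x^{(2)})$ satisfies $0\le b<d\le S$, $$\left|T_\ell(x^{(1)},x^{(2)})-T_\ell(\tilde x^{(1)},\tilde x^{(2)})\right|\le C_T\sqrt{d_\ast\left((x^{(1)},x^{(2)}),(\tilde x^{(1)},\tilde x^{(2)})\right)},$$ where $C_T:=\sqrt{2S\,C_\phi\,C_{\mathrm{Density}}}$, $$C_\phi:=\frac{1+\theta}{(\gamma+\theta)\log 2}\left(1+\frac{2(1-\gamma)}{\theta}\right),\qquad C_{\mathrm{Density}}:=\frac{8(1-\gamma)}{S^2}\left(\frac1\theta+\frac1{\theta^2}\right).$$
   Context: $\|\cdot\|$ is the Euclidean norm; $\log$ is the natural logarithm. Vietoris--Rips diagram: for $x=(x_1,\ldots,x_N)\in(\mathbb{R}^d)^N$, the filtration on all nonempty $\sigma\subset\{1,\ldots,N\}$ is $\Phi_\sigma(x)=\max_{i,j\in\sigma}\|x_i-x_j\|$, and $\mathcal{D}_\ell(x)$ is its persistence diagram in degree $\ell$ (coefficients in $\mathbb{Z}/2\mathbb{Z}$), the multiset of birth--death pairs $(b,d)$, $b<d\le\infty$. Persistence landscape: for a pair $(b,d)$ with $d<\infty$ let $f_{(b,d)}(t)=t-b$ if $b\le t\le\frac{b+d}2$, $=d-t$ if $\frac{b+d}{2}<t\le d$, and $0$ otherwise. For a diagram $D$, $\lambda_{\ell,m}(D)(t)$ is the $m$-th largest value (with multiplicity) among $f_{(b,d)}(t)$, $(b,d)\in D$, $d<\infty$, and $0$ if $m$ exceeds the number of such pairs. Set $\Lambda_\ell^{(M)}(D)(t)=\sum_{m=1}^M\lambda_{\ell,m}(D)(t)$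 for $t\in[0,S]$, $A_\ell(D)=\int_0^S\Lambda_\ell^{(M)}(D)(t)\,dt$, $A_{\mathrm{max}}=MS^2/4$, $u_S(t)=1/S$ on $[0,S]$. PL+JS statistic: define the probability density on $[0,S]$ $$p_\ell^{(\gamma,\theta)}(D)(t)=(1-\gamma)\frac{\Lambda_\ell^{(M)}(D)(t)+\theta A_{\mathrm{max}}u_S(t)}{A_\ell(D)+\theta A_{\mathrm{max}}}+\gamma u_S(t),$$ and $\Delta_\ell(D,D')=d_{\mathrm{JS}}(p_\ell^{(\gamma,\theta)}(D),p_\ell^{(\gamma,\theta)}(D'))$, where $d_{\mathrm{JS}}(p,q)=\sqrt{\mathrm{JS}(p\Vert q)}$, $\mathrm{JS}(p\Vert q)=\frac12\int_0^S p\log_2\frac{p}{m}\,dt+\frac12\int_0^S q\log_2\frac{q}{m}\,dt$, $m=\frac12(p+q)$. *)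

theory Defs
  imports "HOL-Analysis.Analysis" "HOL-Library.Z2" "HOL-Library.Multiset" "HOL-Library.Extended_Real"
begin

text \<open>
  Coefficients are in Z/2. A simplex is a nonempty set of vertices, a complex is a set of simplices, and a chain assigns to
  every vertex set a coefficient in the two-element field \<^typ>\<open>bit\<close>. Chains form a vector space
  under \<^term>\<open>(*s)\<close>, and \<^term>\<open>vec.dim\<close> is the library's dimension in that space.
\<close>

definition chains :: "nat \<Rightarrow> 'v::finite set set \<Rightarrow> (bit ^ ('v set)) set" where
  "chains l K = {c. \<forall>\<sigma>. c $ \<sigma> \<noteq> 0 \<longrightarrow> \<sigma> \<in> K \<and> card \<sigma> = Suc l}"

text \<open>The homology is not reduced: the empty set is not a simplex, so vertices have boundary 0.\<close>

definition boundary :: "bit ^ ('v::finite set) \<Rightarrow> bit ^ ('v set)" where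
  "boundary c = (\<chi> \<tau>. if \<tau> = {} then 0 else \<Sum>v\<in>-\<tau>. c $ insert v \<tau>)"

definition cycles :: "nat \<Rightarrow> 'v::finite set set \<Rightarrow> (bit ^ ('v set)) set" where
  "cycles l K = {c \<in> chains l K. boundary c = 0}"

definition boundaries :: "nat \<Rightarrow> 'v::finite set set \<Rightarrow> (bit ^ ('v set)) set" where
  "boundaries l K = boundary ` chains (Suc l) K"

text \<open>
  For complexes \<open>K \<subseteq> L\<close>, the image of the map \<open>H_l(K) \<rightarrow> H_l(L)\<close> induced by the inclusion is
  \<open>Z_l(K) / (Z_l(K) \<inter> B_l(L))\<close>; its dimension is the persistent Betti number of the pair.
\<close>

definition persistent_betti :: "nat \<Rightarrow> 'v::finite set set \<Rightarrow> 'v set set \<Rightarrow> nat" where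
  "persistent_betti l K L = vec.dim (cycles l K) - vec.dim (cycles l K \<inter> boundaries l L)"

type_synonym diagram = "(real \<times> ereal) multiset"

definition sublevel :: "('v::finite set \<Rightarrow> real) \<Rightarrow> ereal \<Rightarrow> 'v set set" where
  "sublevel f a = {\<sigma>. \<sigma> \<noteq> {} \<and> ereal (f \<sigma>) \<le> a}"

definition strict_sublevel :: "('v::finite set \<Rightarrow> real) \<Rightarrow> ereal \<Rightarrow> 'v set set" where
  "strict_sublevel f a = {\<sigma>. \<sigma> \<noteq> {} \<and> ereal (f \<sigma>) < a}"

text \<open>
  The multiplicity of \<open>(b, d)\<close> is the usual alternating sum of persistent Betti numbers. As the
  filtration takes finitely many values, its complexes just before the values \<open>b\<close> and \<open>d\<close> are the
  strict sublevel complexes. The first summand counts the classes born at \<open>b\<close> that are alive just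
  before \<open>d\<close>, the second one those among them that survive \<open>d\<close>; for \<open>d = \<infinity>\<close> nothing is subtracted.
\<close>

definition multiplicity_pd :: "nat \<Rightarrow> ('v::finite set \<Rightarrow> real) \<Rightarrow> real \<Rightarrow> ereal \<Rightarrow> int" where
  "multiplicity_pd l f b d =
     (int (persistent_betti l (sublevel f b) (strict_sublevel f d))
       - int (persistent_betti l (strict_sublevel f b) (strict_sublevel f d)))
   - (if d = \<infinity> then 0
      else int (persistent_betti l (sublevel f b) (sublevel f d))
         - int (persistent_betti l (strict_sublevel f b) (sublevel f d)))"

text \<open>Births and finite deaths occur only at values of the filtration.\<close>

definition persistence_diagram :: "nat \<Rightarrow> ('v::finite set \<Rightarrow> real) \<Rightarrow> diagram" where
  "persistence_diagram l f =
     (\<Sum>(b, d) \<in> {(b, d). b \<in> f ` {\<sigma>. \<sigma> \<noteq> {}} \<and>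
                       d \<in> insert \<infinity> ((\<lambda>\<sigma>. ereal (f \<sigma>)) ` {\<sigma>. \<sigma> \<noteq> {}}) \<and> ereal b < d}.
        replicate_mset (nat (multiplicity_pd l f b d)) (b, d))"

definition vr_filtration :: "('a::euclidean_space) ^ ('n::finite) \<Rightarrow> 'n set \<Rightarrow> real" where
  "vr_filtration x \<sigma> = (MAX (i, j) \<in> \<sigma> \<times> \<sigma>. norm (x $ i - x $ j))"

definition vr_diagram :: "nat \<Rightarrow> ('a::euclidean_space) ^ ('n::finite) \<Rightarrow> diagram" where
  "vr_diagram l x = persistence_diagram l (vr_filtration x)"

definition tent :: "real \<times> real \<Rightarrow> real \<Rightarrow> real" where
  "tent p t = (let (b, d) = p in
     if b \<le> t \<and> t \<le> (b + d) / 2 then t - b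
     else if (b + d) / 2 < t \<and> t \<le> d then d - t
     else 0)"

definition finite_pairs :: "diagram \<Rightarrow> (real \<times> real) multiset" where
  "finite_pairs D = image_mset (\<lambda>(b, d). (b, real_of_ereal d)) {#p \<in># D. snd p < \<infinity>#}"

text \<open>The index \<open>m\<close> starts at 1, while list positions start at 0.\<close>

definition landscape :: "nat \<Rightarrow> diagram \<Rightarrow> real \<Rightarrow> real" where
  "landscape m D t =
     (let vs = rev (sorted_list_of_multiset (image_mset (\<lambda>p. tent p t) (finite_pairs D)))
      in if m \<le> length vs then vs ! (m - 1) else 0)"

definition landscape_sum :: "nat \<Rightarrow> diagram \<Rightarrow> real \<Rightarrow> real" where
  "landscape_sum M D t = (\<Sum>m = 1..M. landscape m D t)"

definition landscape_area :: "nat \<Rightarrow> real \<Rightarrow> diagram \<Rightarrow> real" where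
  "landscape_area M S D = integral {0..S} (landscape_sum M D)"

definition max_area :: "nat \<Rightarrow> real \<Rightarrow> real" where
  "max_area M S = real M * S\<^sup>2 / 4"

definition uniform_density :: "real \<Rightarrow> real \<Rightarrow> real" where
  "uniform_density S t = (if t \<in> {0..S} then 1 / S else 0)"

definition pl_density :: "nat \<Rightarrow> real \<Rightarrow> real \<Rightarrow> real \<Rightarrow> diagram \<Rightarrow> real \<Rightarrow> real" where
  "pl_density M S \<gamma> \<theta> D t =
     (1 - \<gamma>) * ((landscape_sum M D t + \<theta> * max_area M S * uniform_density S t)
                / (landscape_area M S D + \<theta> * max_area M S))
     + \<gamma> * uniform_density S t"

definition js_divergence :: "real \<Rightarrow> (real \<Rightarrow> real) \<Rightarrow> (real \<Rightarrow> real) \<Rightarrow> real" where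
  "js_divergence S p q =
     (let m = (\<lambda>t. (p t + q t) / 2) in
      1 / 2 * integral {0..S} (\<lambda>t. p t * log 2 (p t / m t))
      + 1 / 2 * integral {0..S} (\<lambda>t. q t * log 2 (q t / m t)))"

definition js_distance :: "real \<Rightarrow> (real \<Rightarrow> real) \<Rightarrow> (real \<Rightarrow> real) \<Rightarrow> real" where
  "js_distance S p q = sqrt (js_divergence S p q)"

definition pljs :: "nat \<Rightarrow> real \<Rightarrow> real \<Rightarrow> real \<Rightarrow> diagram \<Rightarrow> diagram \<Rightarrow> real" where
  "pljs M S \<gamma> \<theta> D D' = js_distance S (pl_density M S \<gamma> \<theta> D) (pl_density M S \<gamma> \<theta> D')"

definition pljs_vr :: "nat \<Rightarrow> nat \<Rightarrow> real \<Rightarrow> real \<Rightarrow> real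
    \<Rightarrow> ('a::euclidean_space) ^ ('n1::finite) \<Rightarrow> 'a ^ ('n2::finite) \<Rightarrow> real" where
  "pljs_vr l M S \<gamma> \<theta> x1 x2 = pljs M S \<gamma> \<theta> (vr_diagram l x1) (vr_diagram l x2)"

definition hausdorff_config :: "('a::euclidean_space) ^ ('n::finite) \<Rightarrow> 'a ^ 'n \<Rightarrow> real" where
  "hausdorff_config x y =
     max (MAX i. MIN j. norm (x $ i - y $ j)) (MAX j. MIN i. norm (x $ i - y $ j))"

definition hausdorff_pair ::
  "(('a::euclidean_space) ^ ('n1::finite)) \<times> ('a ^ ('n2::finite))
    \<Rightarrow> ('a ^ 'n1) \<times> ('a ^ 'n2) \<Rightarrow> real" where
  "hausdorff_pair X Y = hausdorff_config (fst X) (fst Y) + hausdorff_config (snd X) (snd Y)"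

definition C_phi :: "real \<Rightarrow> real \<Rightarrow> real" where
  "C_phi \<gamma> \<theta> = (1 + \<theta>) / ((\<gamma> + \<theta>) * ln 2) * (1 + 2 * (1 - \<gamma>) / \<theta>)"

definition C_Density :: "real \<Rightarrow> real \<Rightarrow> real \<Rightarrow> real" where
  "C_Density S \<gamma> \<theta> = 8 * (1 - \<gamma>) / S\<^sup>2 * (1 / \<theta> + 1 / \<theta>\<^sup>2)"

definition C_T :: "real \<Rightarrow> real \<Rightarrow> real \<Rightarrow> real" where
  "C_T S \<gamma> \<theta> = sqrt (2 * S * C_phi \<gamma> \<theta> * C_Density S \<gamma> \<theta>)"

definition finite_pairs_within :: "real \<Rightarrow> diagram \<Rightarrow> bool" where
  "finite_pairs_within S D \<longleftrightarrow> (\<forall>(b, d) \<in> set_mset (finite_pairs D). 0 \<le> b \<and> b < d \<and> d \<le> S)"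

end

theory Submission
  imports Defs
begin

text \<open>
  Let \<open>\<epsilon>\<close> be the Hausdorff distance of \<open>x\<close> and \<open>y\<close>. Inside the Rips complexes of the union of the two
  clouds, the vertices of \<open>x\<close> can be moved to nearest points of \<open>y\<close>, one at a time and by chain
  homotopies, and conversely. Hence \<open>x\<close> has at most as many finite pairs with \<open>b \<le> t - h - 2\<epsilon>\<close>,
  \<open>d \<ge> t + h + 2\<epsilon>\<close> as \<open>y\<close> has with \<open>b \<le> t - h\<close>, \<open>d \<ge> t + h\<close>. Since these numbers count the tents
  that are at least \<open>h\<close> at \<open>t\<close>, every landscape moves by at most \<open>2\<epsilon>\<close>; no matching of diagrams is
  needed. The densities then move uniformly by at most \<open>2 C_Density \<epsilon>\<close>. On the range of the densities the
  Jensen--Shannon integrand is Lipschitz with constant \<open>C_phi / 2\<close> in each argument, because it is convex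
  with logarithmic partial derivatives. Finally \<open>|sqrt u - sqrt v| \<le> sqrt |u - v|\<close>.
\<close>

subsection \<open>Linear algebra over the field with two elements\<close>

text \<open>The default simp rules turn sums of bits into case distinctions on their values.\<close>

declare Z2.add_bit_eq_xor [simp del] Z2.mult_bit_eq_and [simp del] Z2.bit_not_zero_iff [simp del]

lemma bit_add_self [simp]: "(a :: bit) + a = 0"
  by (cases a) (simp_all add: Z2.add_bit_eq_xor)

lemma bit_vec_add_self [simp]: "(x :: bit ^ 'n) + x = 0"
  by (simp add: vec_eq_iff)

lemma bit_vec_add_self_left [simp]: "(x :: bit ^ 'n) + (x + y) = y"
  by (metis add.assoc add_0 bit_vec_add_self)

text \<open>The only scalars are 0 and 1, so additivity already gives homogeneity.\<close>

lemma bit_linearI: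
  fixes f :: "bit ^ 'm::finite \<Rightarrow> bit ^ 'n::finite"
  assumes add: "\<And>x y. f (x + y) = f x + f y"
  shows "Vector_Spaces.linear (*s) (*s) f"
proof -
  have zero: "f 0 = 0"
    using add[of 0 0] by simp
  have "f (r *s x) = r *s f x" for r x
    by (cases r) (simp_all add: zero)
  then show ?thesis
    using add by unfold_locales auto
qed

lemma bit_subspaceI:
  fixes S :: "(bit ^ 'n::finite) set"
  assumes "0 \<in> S" and add: "\<And>x y. x \<in> S \<Longrightarrow> y \<in> S \<Longrightarrow> x + y \<in> S"
  shows "vec.subspace S"
proof (rule vec.subspaceI)
  show "c *s x \<in> S" if "x \<in> S" for c :: bit and x
    using that assms(1) by (cases c) auto
qed (use assms in auto)

text \<open>\<open>F0\<close> puts the kernel of the map from \<open>U1\<close> to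
  \<open>W1 / W0\<close> inside \<open>U0\<close>, so a complement of \<open>U0\<close> in
  \<open>U1\<close> embeds into \<open>W1 / W0\<close>. Sums replace differences because the
  dimensions are natural numbers.\<close>

lemma dim_quotient_mono:
  fixes F :: "bit ^ 'm::finite \<Rightarrow> bit ^ 'n::finite"
  assumes F: "Vector_Spaces.linear (*s) (*s) F"
    and U1: "vec.subspace U1" and U0: "vec.subspace U0" and U01: "U0 \<subseteq> U1"
    and W1: "vec.subspace W1" and W0: "vec.subspace W0" and W01: "W0 \<subseteq> W1"
    and F1: "\<And>z. z \<in> U1 \<Longrightarrow> F z \<in> W1"
    and F0: "\<And>z. z \<in> U1 \<Longrightarrow> F z \<in> W0 \<Longrightarrow> z \<in> U0"
  shows "vec.dim U1 + vec.dim W0 \<le> vec.dim W1 + vec.dim U0"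
proof -
  obtain B0 where B0: "B0 \<subseteq> U0" "vec.independent B0" "U0 \<subseteq> vec.span B0"
    using vec.maximal_independent_subset by blast
  obtain B where B: "B0 \<subseteq> B" "B \<subseteq> U1" "vec.independent B" "U1 \<subseteq> vec.span B"
    using vec.maximal_independent_subset_extend[of B0 U1] B0 U01 by blast
  have finB: "finite B"
    using B(3) vec.finiteI_independent by blast
  \<comment> \<open>The basis vectors added to those of \<open>U0\<close> span a complement of
    \<open>U0\<close> in \<open>U1\<close>. Its trivial intersection with \<open>U0\<close> is read
    off below from the dimension formula for sums.\<close>
  define C where "C = vec.span (B - B0)"
  have C: "vec.subspace C" unfolding C_def by simp
  have CU1: "C \<subseteq> U1"
    unfolding C_def using B(2) U1 by (intro vec.span_minimal) auto
  have dC: "vec.dim C = card (B - B0)"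
    unfolding C_def by (rule vec.dim_span_eq_card_independent) (use B vec.independent_mono in blast)
  have dU0: "vec.dim U0 = card B0"
    using vec.basis_card_eq_dim[OF B0(1) B0(3) B0(2)] by simp
  have dU1: "vec.dim U1 = card B"
    using vec.basis_card_eq_dim[OF B(2) B(4) B(3)] by simp
  have dU: "vec.dim U1 = vec.dim C + vec.dim U0"
    using dC dU0 dU1 B(1) finB by (metis add.commute card_Diff_subset card_mono finite_subset le_add_diff_inverse)
  have "U1 \<subseteq> {x + y |x y. x \<in> C \<and> y \<in> U0}"
  proof
    fix z assume "z \<in> U1"
    then have "z \<in> vec.span ((B - B0) \<union> B0)"
      using B(1,4) by (metis Diff_partition Un_commute subsetD)
    then obtain x y where "z = x + y" "x \<in> vec.span (B - B0)" "y \<in> vec.span B0"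
      unfolding vec.span_Un by auto
    moreover have "vec.span B0 \<subseteq> U0"
      using B0(1) U0 by (simp add: vec.span_minimal)
    ultimately show "z \<in> {x + y |x y. x \<in> C \<and> y \<in> U0}"
      unfolding C_def by auto
  qed
  then have "vec.dim U1 \<le> vec.dim {x + y |x y. x \<in> C \<and> y \<in> U0}"
    by (rule vec.dim_subset)
  with vec.dim_sums_Int[OF C U0] dU have "vec.dim (C \<inter> U0) = 0"
    by (simp del: vec.dim_eq_0)
  then have CU0: "C \<inter> U0 \<subseteq> {0}"
    by simp
  interpret F: Vector_Spaces.linear "(*s)" "(*s)" F by (rule F)
  have W00: "0 \<in> W0" using W0 vec.subspace_0 by blast
  have "inj_on F C"
  proof (rule inj_onI)
    fix x y assume xy: "x \<in> C" "y \<in> C" "F x = F y"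
    then have "x - y \<in> C" "F (x - y) = 0"
      using C by (auto simp: F.diff vec.subspace_diff)
    then have "x - y \<in> C \<inter> U0"
      using F0 CU1 W00 by auto
    then show "x = y" using CU0 by auto
  qed
  then have dFC: "vec.dim (F ` C) = vec.dim C"
    using vec.dim_image_eq[OF F] C by (metis vec.span_eq_iff)
  have FC: "vec.subspace (F ` C)"
    using C F.subspace_image by blast
  have "F ` C \<inter> W0 \<subseteq> {0}"
  proof
    fix w assume "w \<in> F ` C \<inter> W0"
    then obtain z where "z \<in> C" "w = F z" "F z \<in> W0" by auto
    then have "z \<in> C \<inter> U0" using F0 CU1 by auto
    then have "z = 0" using CU0 by auto
    then show "w \<in> {0}" using \<open>w = F z\<close> F.zero by auto
  qed
  then have "vec.dim (F ` C \<inter> W0) = 0" by simp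
  \<comment> \<open>The image of \<open>C\<close>, on which \<open>F\<close> is injective, and
    \<open>W0\<close> form a direct sum inside \<open>W1\<close>.\<close>
  moreover have "{x + y |x y. x \<in> F ` C \<and> y \<in> W0} \<subseteq> W1"
    using F1 CU1 W01 W1 by (auto intro!: vec.subspace_add)
  then have "vec.dim {x + y |x y. x \<in> F ` C \<and> y \<in> W0} \<le> vec.dim W1"
    by (rule vec.dim_subset)
  ultimately show ?thesis
    using vec.dim_sums_Int[OF FC W0] dFC dU by (simp del: vec.dim_eq_0)
qed

subsection \<open>Chain homotopies and interleavings\<close>

lemma chains_mono: "K \<subseteq> L \<Longrightarrow> chains l K \<subseteq> chains l L"
  unfolding chains_def by blast

lemma cycles_mono: "K \<subseteq> L \<Longrightarrow> cycles l K \<subseteq> cycles l L"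
  unfolding cycles_def using chains_mono by blast

lemma boundaries_mono: "K \<subseteq> L \<Longrightarrow> boundaries l K \<subseteq> boundaries l L"
  unfolding boundaries_def using chains_mono by blast

lemma boundary_add: "boundary (x + y) = boundary x + boundary y"
  by (simp add: boundary_def vec_eq_iff sum.distrib)

lemma boundary_zero [simp]: "boundary 0 = 0"
  by (simp add: boundary_def vec_eq_iff)

lemma chains_zero [simp]: "0 \<in> chains l K"
  by (simp add: chains_def)

lemma chains_add: "x \<in> chains l K \<Longrightarrow> y \<in> chains l K \<Longrightarrow> x + y \<in> chains l K"
  unfolding chains_def mem_Collect_eq vector_add_component by (metis add_0)

lemma subspace_cycles: "vec.subspace (cycles l K)"
  by (rule bit_subspaceI) (auto simp: cycles_def boundary_add chains_add)

lemma subspace_boundaries: "vec.subspace (boundaries l K)"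
proof (rule bit_subspaceI)
  show "0 \<in> boundaries l K"
    unfolding boundaries_def by (metis boundary_zero chains_zero image_eqI)
  show "x + y \<in> boundaries l K" if "x \<in> boundaries l K" "y \<in> boundaries l K" for x y
    using that unfolding boundaries_def by (auto simp flip: boundary_add intro: chains_add)
qed

text \<open>The terms \<open>f x y\<close> and \<open>f y x\<close> are equal and cancel in
  characteristic two. This is the reason why the boundary squares to zero.\<close>

lemma sum_symmetric_bit:
  fixes f :: "'a \<Rightarrow> 'a \<Rightarrow> bit"
  assumes "finite A" and sym: "\<And>x y. f x y = f y x"
  shows "(\<Sum>x\<in>A. \<Sum>y\<in>A - {x}. f x y) = 0"
  using \<open>finite A\<close>
proof (induction A)
  case (insert a A)
  have "(\<Sum>x\<in>A. \<Sum>y\<in>insert a A - {x}. f x y) = (\<Sum>x\<in>A. f x a + (\<Sum>y\<in>A - {x}. f x y))"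
  proof (rule sum.cong[OF refl])
    fix x assume "x \<in> A"
    then have "insert a A - {x} = insert a (A - {x})" using insert by auto
    then show "(\<Sum>y\<in>insert a A - {x}. f x y) = f x a + (\<Sum>y\<in>A - {x}. f x y)"
      using insert by simp
  qed
  also have "\<dots> = (\<Sum>x\<in>A. f a x)"
    using insert sym by (simp add: sum.distrib)
  finally show ?case using insert by simp
qed simp

lemma boundary_boundary [simp]: "boundary (boundary c) = 0"
proof -
  have "(\<Sum>v\<in>-\<tau>. boundary c $ insert v \<tau>) = 0" for \<tau>
  proof -
    have "(\<Sum>v\<in>-\<tau>. boundary c $ insert v \<tau>)
        = (\<Sum>v\<in>-\<tau>. \<Sum>w\<in>-\<tau> - {v}. c $ insert w (insert v \<tau>))"
      by (intro sum.cong) (auto simp: boundary_def intro!: sum.cong)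
    also have "\<dots> = 0"
      by (rule sum_symmetric_bit) (auto simp: insert_commute)
    finally show ?thesis .
  qed
  then show ?thesis by (simp add: boundary_def[of "boundary c"] vec_eq_iff)
qed

text \<open>\<open>collapse u w\<close> is the chain map induced by the vertex map that sends \<open>u\<close> to \<open>w\<close> and fixes all other
  vertices, and \<open>prism u w\<close> is a chain homotopy from it to the identity. Moving one vertex at a time
  avoids the vertex orders that a prism operator for general contiguous maps needs.\<close>

definition prism :: "'v \<Rightarrow> 'v \<Rightarrow> bit ^ ('v::finite set) \<Rightarrow> bit ^ ('v set)" where
  "prism u w c = (\<chi> \<tau>. if u \<in> \<tau> \<and> w \<in> \<tau> then c $ (\<tau> - {w}) else 0)"

definition collapse :: "'v \<Rightarrow> 'v \<Rightarrow> bit ^ ('v::finite set) \<Rightarrow> bit ^ ('v set)" where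
  "collapse u w c = (\<chi> \<tau>. if u \<in> \<tau> then 0
     else if w \<in> \<tau> then c $ \<tau> + c $ (insert u \<tau> - {w}) else c $ \<tau>)"

lemma prism_zero [simp]: "prism u w 0 = 0"
  by (simp add: prism_def vec_eq_iff)

lemma collapse_homotopy:
  assumes "u \<noteq> w"
  shows "collapse u w c = c + boundary (prism u w c) + prism u w (boundary c)"
proof -
  have "collapse u w c $ \<tau> = c $ \<tau> + boundary (prism u w c) $ \<tau> + prism u w (boundary c) $ \<tau>" for \<tau>
  proof (cases "\<tau> = {}")
    case True
    then show ?thesis by (simp add: collapse_def boundary_def prism_def)
  next
    case ne: False
    define S where "S = (\<Sum>v\<in>-\<tau>. prism u w c $ insert v \<tau>)"
    have S: "boundary (prism u w c) $ \<tau> = S"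
      using ne by (simp add: boundary_def S_def)
    consider (both) "u \<in> \<tau>" "w \<in> \<tau>" | (u) "u \<in> \<tau>" "w \<notin> \<tau>" | (w) "u \<notin> \<tau>" "w \<in> \<tau>"
      | (none) "u \<notin> \<tau>" "w \<notin> \<tau>" by blast
    then show ?thesis
    proof cases
      case both
      \<comment> \<open>Re-inserting \<open>w\<close> contributes \<open>c $ \<tau>\<close>, and the
        other terms are those of \<open>S\<close>; so everything on the right-hand side occurs
        twice.\<close>
      have "prism u w (boundary c) $ \<tau> = (\<Sum>v\<in>-(\<tau> - {w}). c $ insert v (\<tau> - {w}))"
        using both assms by (auto simp: prism_def boundary_def)
      also have "-(\<tau> - {w}) = insert w (-\<tau>)" using both by auto
      also have "(\<Sum>v\<in>\<dots>. c $ insert v (\<tau> - {w})) = c $ \<tau> + (\<Sum>v\<in>-\<tau>. c $ insert v (\<tau> - {w}))"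
        using both by (simp add: insert_absorb)
      also have "(\<Sum>v\<in>-\<tau>. c $ insert v (\<tau> - {w})) = S"
        unfolding S_def
      proof (rule sum.cong[OF refl])
        fix v assume "v \<in> -\<tau>"
        then have "insert v \<tau> - {w} = insert v (\<tau> - {w})" using both by auto
        then show "c $ insert v (\<tau> - {w}) = prism u w c $ insert v \<tau>"
          using both by (simp add: prism_def)
      qed
      finally have eq: "prism u w (boundary c) $ \<tau> = c $ \<tau> + S" .
      have "c $ \<tau> + S + (c $ \<tau> + S) = 0" by (rule bit_add_self)
      then show ?thesis
        unfolding S eq using both by (simp add: collapse_def)
    next
      case u
      \<comment> \<open>Only inserting \<open>w\<close> gives a set that contains both
        \<open>u\<close> and \<open>w\<close>. In the next case only inserting \<open>u\<close>
        does, and in the last case no single vertex suffices.\<close>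
      have "S = (\<Sum>v\<in>-\<tau>. if v = w then c $ \<tau> else 0)"
        unfolding S_def by (rule sum.cong) (use u in \<open>auto simp: prism_def\<close>)
      then have "S = c $ \<tau>" using u by simp
      then show ?thesis using u S by (simp add: collapse_def prism_def)
    next
      case w
      have "S = (\<Sum>v\<in>-\<tau>. if v = u then c $ (insert u \<tau> - {w}) else 0)"
        unfolding S_def by (rule sum.cong) (use w in \<open>auto simp: prism_def\<close>)
      then have "S = c $ (insert u \<tau> - {w})" using w by simp
      then show ?thesis using w S by (simp add: collapse_def prism_def)
    next
      case none
      have "S = (\<Sum>v\<in>-\<tau>. 0)"
        unfolding S_def by (rule sum.cong) (use none assms in \<open>auto simp: prism_def\<close>)
      then show ?thesis using none S by (simp add: collapse_def prism_def)
    qed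
  qed
  then show ?thesis by (simp add: vec_eq_iff)
qed

lemma collapse_add: "collapse u w (x + y) = collapse u w x + collapse u w y"
  by (simp add: collapse_def vec_eq_iff algebra_simps)

text \<open>The homotopy formula expands both sides, and the terms in which they differ contain a
  squared boundary.\<close>

lemma collapse_boundary:
  assumes "u \<noteq> w"
  shows "collapse u w (boundary c) = boundary (collapse u w c)"
  by (simp add: collapse_homotopy[OF assms] boundary_add)

text \<open>This is the clique complex of \<open>R\<close>. A vertex is present only if
  \<open>R i i\<close>, so Rips complexes at negative scales are empty.\<close>

definition flag :: "('v \<Rightarrow> 'v \<Rightarrow> bool) \<Rightarrow> 'v set set" where
  "flag R = {\<sigma>. \<sigma> \<noteq> {} \<and> (\<forall>i\<in>\<sigma>. \<forall>j\<in>\<sigma>. R i j)}"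

text \<open>The condition keeps in \<open>K\<close> both the prism, which adds \<open>p u\<close> to
  a simplex through \<open>u\<close>, and the collapse, which replaces \<open>u\<close> by
  \<open>p u\<close>. Ranging over all nonempty subsets supplies the faces that the collapse
  produces.\<close>

definition absorbs :: "'v set \<Rightarrow> ('v \<Rightarrow> 'v) \<Rightarrow> 'v set set \<Rightarrow> bool" where
  "absorbs U p K \<longleftrightarrow> (\<forall>\<sigma>\<in>K. \<forall>u\<in>U \<inter> \<sigma>. \<forall>\<tau>. \<tau> \<noteq> {} \<longrightarrow> \<tau> \<subseteq> insert (p u) \<sigma> \<longrightarrow> \<tau> \<in> K)"

lemma prism_chains:
  assumes K: "absorbs {u} (\<lambda>_. w) K" and "u \<noteq> w" and c: "c \<in> chains l K"
  shows "prism u w c \<in> chains (Suc l) K"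
proof -
  have "\<tau> \<in> K \<and> card \<tau> = Suc (Suc l)" if "prism u w c $ \<tau> \<noteq> 0" for \<tau>
  proof -
    have \<tau>: "u \<in> \<tau>" "w \<in> \<tau>" "c $ (\<tau> - {w}) \<noteq> 0"
      using that by (auto simp: prism_def split: if_splits)
    then have "\<tau> - {w} \<in> K" "card (\<tau> - {w}) = Suc l"
      using c by (auto simp: chains_def)
    moreover have "\<tau> \<subseteq> insert w (\<tau> - {w})" "u \<in> {u} \<inter> (\<tau> - {w})" "\<tau> \<noteq> {}"
      using \<tau> \<open>u \<noteq> w\<close> by auto
    ultimately have "\<tau> \<in> K" using K unfolding absorbs_def by blast
    moreover have "card \<tau> = Suc (card (\<tau> - {w}))"
      using \<tau> by (simp add: card_Suc_Diff1 del: card_Diff_insert)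
    ultimately show ?thesis using \<open>card (\<tau> - {w}) = Suc l\<close> by simp
  qed
  then show ?thesis by (simp add: chains_def)
qed

lemma collapse_chains:
  assumes K: "absorbs {u} (\<lambda>_. w) K" and "u \<noteq> w" and c: "c \<in> chains l K"
  shows "collapse u w c \<in> chains l {\<sigma>\<in>K. u \<notin> \<sigma>}"
proof -
  have "\<tau> \<in> K \<and> u \<notin> \<tau> \<and> card \<tau> = Suc l" if "collapse u w c $ \<tau> \<noteq> 0" for \<tau>
  proof -
    have "u \<notin> \<tau>" and "c $ \<tau> \<noteq> 0 \<or> w \<in> \<tau> \<and> c $ (insert u \<tau> - {w}) \<noteq> 0"
      using that by (auto simp: collapse_def split: if_splits)
    moreover have "\<tau> \<in> K \<and> card \<tau> = Suc l" if "w \<in> \<tau>" "c $ (insert u \<tau> - {w}) \<noteq> 0" "u \<notin> \<tau>"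
    proof -
      have "insert u \<tau> - {w} \<in> K" "card (insert u \<tau> - {w}) = Suc l"
        using that c by (auto simp: chains_def)
      moreover have "\<tau> \<subseteq> insert w (insert u \<tau> - {w})" "u \<in> insert u \<tau> - {w}" "\<tau> \<noteq> {}"
        using that \<open>u \<noteq> w\<close> by auto
      moreover have "card (insert u \<tau> - {w}) = card \<tau>"
        using that by simp
      ultimately show ?thesis
        using K unfolding absorbs_def by auto
    qed
    ultimately show ?thesis using c by (auto simp: chains_def)
  qed
  then show ?thesis by (simp add: chains_def)
qed

text \<open>The clauses are uniform in \<open>K\<close> and \<open>l\<close> because one map has to
  act on several complexes at once. The last clause says that \<open>F\<close> is homologous to the
  identity on cycles.\<close>

definition chain_retraction ::
    "'v set \<Rightarrow> ('v \<Rightarrow> 'v) \<Rightarrow> (bit ^ ('v::finite set) \<Rightarrow> bit ^ ('v set)) \<Rightarrow> bool" where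
  "chain_retraction U p F \<longleftrightarrow>
    (\<forall>x y. F (x + y) = F x + F y) \<and> (\<forall>c. F (boundary c) = boundary (F c)) \<and>
    (\<forall>c. (\<forall>\<sigma>. c $ \<sigma> \<noteq> 0 \<longrightarrow> \<sigma> \<inter> U = {}) \<longrightarrow> F c = c) \<and>
    (\<forall>K l. absorbs U p K \<longrightarrow> (\<forall>c\<in>chains l K. F c \<in> chains l {\<sigma>\<in>K. \<sigma> \<inter> U = {}})) \<and>
    (\<forall>K l. absorbs U p K \<longrightarrow> (\<forall>z\<in>cycles l K. z + F z \<in> boundaries l K))"

lemma chain_retractionD:
  assumes "chain_retraction U p F"
  shows "F (x + y) = F x + F y"
    and "F (boundary c) = boundary (F c)"
    and "(\<And>\<sigma>. c $ \<sigma> \<noteq> 0 \<Longrightarrow> \<sigma> \<inter> U = {}) \<Longrightarrow> F c = c"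
    and "absorbs U p K \<Longrightarrow> c \<in> chains l K \<Longrightarrow> F c \<in> chains l {\<sigma>\<in>K. \<sigma> \<inter> U = {}}"
    and "absorbs U p K \<Longrightarrow> z \<in> cycles l K \<Longrightarrow> z + F z \<in> boundaries l K"
  using assms unfolding chain_retraction_def by blast+

text \<open>The collapses of the single vertices of \<open>U\<close> are composed. As
  \<open>p\<close> takes values outside \<open>U\<close>, no vertex that was removed
  reappears.\<close>

lemma chain_retraction_exists:
  fixes p :: "'v::finite \<Rightarrow> 'v"
  assumes "p ` U \<inter> U = {}"
  shows "\<exists>F. chain_retraction U p F"
  using finite[of U] assms
proof (induction U rule: finite_induct)
  case empty
  have "0 \<in> boundaries l K" for l and K :: "'v set set"
    by (rule vec.subspace_0[OF subspace_boundaries])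
  then show ?case by (intro exI[of _ "\<lambda>c. c"]) (auto simp: chain_retraction_def)
next
  case (insert u U)
  then obtain F where F: "chain_retraction U p F" by blast
  note F_add = chain_retractionD(1)[OF F] and F_bd = chain_retractionD(2)[OF F]
    and F_id = chain_retractionD(3)[OF F] and F_ch = chain_retractionD(4)[OF F]
    and F_cy = chain_retractionD(5)[OF F]
  define w where "w = p u"
  have w: "u \<noteq> w" "w \<notin> U" using insert.prems by (auto simp: w_def)
  define G where "G c = collapse u w (F c)" for c
  have G_id: "G c = c" if "\<forall>\<sigma>. c $ \<sigma> \<noteq> 0 \<longrightarrow> \<sigma> \<inter> insert u U = {}" for c
  proof -
    have "F c = c" using that by (intro F_id) auto
    moreover have "c $ \<sigma> = 0" if "u \<in> \<sigma>" for \<sigma>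
      using that \<open>\<forall>\<sigma>. c $ \<sigma> \<noteq> 0 \<longrightarrow> \<sigma> \<inter> insert u U = {}\<close> by blast
    then have "collapse u w c = c"
      using w by (auto simp: collapse_def vec_eq_iff)
    ultimately show ?thesis by (simp add: G_def)
  qed
  \<comment> \<open>The third claim says that \<open>u\<close> can still be moved after
    \<open>U\<close> has been cleared: \<open>w\<close> lies outside \<open>U\<close>, so adding it
    keeps simplices disjoint from \<open>U\<close>.\<close>
  have abs: "absorbs U p K" "absorbs {u} (\<lambda>_. w) K" "absorbs {u} (\<lambda>_. w) {\<sigma>\<in>K. \<sigma> \<inter> U = {}}"
    if "absorbs (insert u U) p K" for K
    using that w unfolding absorbs_def w_def by blast+
  have G_ch: "G c \<in> chains l {\<sigma>\<in>K. \<sigma> \<inter> insert u U = {}}"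
    if K: "absorbs (insert u U) p K" and c: "c \<in> chains l K" for K l c
  proof -
    have "F c \<in> chains l {\<sigma>\<in>K. \<sigma> \<inter> U = {}}" using F_ch abs K c by blast
    then have "G c \<in> chains l {\<sigma>\<in>{\<sigma>\<in>K. \<sigma> \<inter> U = {}}. u \<notin> \<sigma>}"
      unfolding G_def using collapse_chains abs(3)[OF K] w(1) by blast
    also have "{\<sigma>\<in>{\<sigma>\<in>K. \<sigma> \<inter> U = {}}. u \<notin> \<sigma>} = {\<sigma>\<in>K. \<sigma> \<inter> insert u U = {}}" by auto
    finally show ?thesis .
  qed
  have G_cy: "z + G z \<in> boundaries l K"
    if K: "absorbs (insert u U) p K" and z: "z \<in> cycles l K" for K l z
  proof -
    have zF: "z + F z \<in> boundaries l K" using F_cy abs K z by blast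
    have "boundary (F z) = 0"
    proof -
      have "F 0 = 0" using F_add[of 0 0] by simp
      then show ?thesis using z by (simp add: cycles_def flip: F_bd)
    qed
    \<comment> \<open>As \<open>F z\<close> is a cycle, only the boundary of the prism survives in
      the homotopy formula.\<close>
    then have "F z + G z = boundary (prism u w (F z))"
      unfolding G_def by (simp add: collapse_homotopy[OF w(1)] add.assoc)
    moreover have "F z \<in> chains l {\<sigma>\<in>K. \<sigma> \<inter> U = {}}"
      using F_ch abs K z unfolding cycles_def by blast
    then have "F z \<in> chains l K" using chains_mono[of "{\<sigma>\<in>K. \<sigma> \<inter> U = {}}" K] by blast
    then have "prism u w (F z) \<in> chains (Suc l) K"
      using prism_chains abs(2)[OF K] w(1) by blast
    ultimately have "F z + G z \<in> boundaries l K" unfolding boundaries_def by simp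
    \<comment> \<open>The two homologies are chained; the middle term occurs twice and
      cancels.\<close>
    then have "(z + F z) + (F z + G z) \<in> boundaries l K"
      using zF vec.subspace_add[OF subspace_boundaries] by blast
    then show ?thesis by (simp add: add.assoc)
  qed
  have "G (x + y) = G x + G y" for x y
    by (simp add: G_def F_add collapse_add)
  moreover have "G (boundary c) = boundary (G c)" for c
    by (simp add: G_def F_bd collapse_boundary[OF w(1)])
  ultimately have "chain_retraction (insert u U) p G"
    unfolding chain_retraction_def using G_id G_ch G_cy by blast
  then show ?case by blast
qed

text \<open>If \<open>L\<close> is the full simplex, \<open>cycle_boundary_dim l K L - cycle_boundary_dim l K K'\<close> is the rank of
  \<open>H_l(K) \<rightarrow> H_l(K')\<close> on the classes that die eventually, which discards the infinite bars.\<close>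

definition cycle_boundary_dim :: "nat \<Rightarrow> 'v::finite set set \<Rightarrow> 'v set set \<Rightarrow> nat" where
  "cycle_boundary_dim l K L = vec.dim (cycles l K \<inter> boundaries l L)"

text \<open>For injective \<open>i\<close> this is the induced chain map, written by coefficients.
  The range test is there because preimages ignore vertices outside the range.\<close>

definition push_chain :: "('v \<Rightarrow> 'w) \<Rightarrow> bit ^ ('v::finite set) \<Rightarrow> bit ^ ('w::finite set)" where
  "push_chain i c = (\<chi> \<tau>. if \<tau> \<subseteq> range i then c $ (i -` \<tau>) else 0)"

lemma push_chain_boundary:
  assumes i: "inj i"
  shows "boundary (push_chain i c) = push_chain i (boundary c)"
proof -
  have "boundary (push_chain i c) $ \<tau> = push_chain i (boundary c) $ \<tau>" for \<tau>
  proof (cases "\<tau> \<subseteq> range i \<and> \<tau> \<noteq> {}")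
    case False
    then show ?thesis by (auto simp: boundary_def push_chain_def)
  next
    case True
    then obtain \<rho> where \<rho>: "\<tau> = i ` \<rho>" by (metis subset_imageE)
    have vim: "i -` (i ` A) = A" for A using i by (rule inj_vimage_image_eq)
    have "boundary (push_chain i c) $ \<tau> = (\<Sum>v\<in>-\<tau>. push_chain i c $ insert v \<tau>)"
      using True by (simp add: boundary_def)
    also have "\<dots> = (\<Sum>v\<in>i ` (-\<rho>). push_chain i c $ insert v \<tau>)"
      by (rule sum.mono_neutral_right) (use i in \<open>auto simp: \<rho> push_chain_def dest: injD\<close>)
    also have "\<dots> = (\<Sum>u\<in>-\<rho>. push_chain i c $ insert (i u) \<tau>)"
      using i by (simp add: sum.reindex inj_on_subset)
    also have "\<dots> = (\<Sum>u\<in>-\<rho>. c $ insert u \<rho>)"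
      by (rule sum.cong) (auto simp: push_chain_def \<rho> vim simp flip: image_insert)
    also have "\<dots> = push_chain i (boundary c) $ \<tau>"
      using True by (auto simp: push_chain_def boundary_def \<rho> vim)
    finally show ?thesis .
  qed
  then show ?thesis by (simp add: vec_eq_iff)
qed

lemma push_chain_image:
  assumes i: "inj i"
  shows "push_chain i ` chains l K = chains l ((`) i ` K)"
proof (intro equalityI subsetI)
  fix c' assume "c' \<in> push_chain i ` chains l K"
  then obtain c where c: "c \<in> chains l K" "c' = push_chain i c" by blast
  have "\<tau> \<in> (`) i ` K \<and> card \<tau> = Suc l" if "c' $ \<tau> \<noteq> 0" for \<tau>
  proof -
    have \<tau>: "\<tau> \<subseteq> range i" "c $ (i -` \<tau>) \<noteq> 0"
      using that c by (auto simp: push_chain_def split: if_splits)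
    then have "i -` \<tau> \<in> K" "card (i -` \<tau>) = Suc l" using c by (auto simp: chains_def)
    moreover have "\<tau> = i ` (i -` \<tau>)" using \<tau> by auto
    ultimately show ?thesis
      using i by (metis card_image imageI inj_on_subset subset_UNIV)
  qed
  then show "c' \<in> chains l ((`) i ` K)" by (simp add: chains_def)
next
  fix c' assume c': "c' \<in> chains l ((`) i ` K)"
  define c :: "bit ^ ('a set)" where "c = (\<chi> \<sigma>. c' $ (i ` \<sigma>))"
  have "c' $ \<tau> = push_chain i c $ \<tau>" for \<tau>
  proof (cases "\<tau> \<subseteq> range i")
    case True
    then show ?thesis by (auto simp: push_chain_def c_def image_vimage_eq Int_absorb2)
  next
    case False
    then have "\<tau> \<notin> (`) i ` K" by auto
    then show ?thesis using c' False by (auto simp: push_chain_def chains_def)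
  qed
  moreover have "\<sigma> \<in> K \<and> card \<sigma> = Suc l" if "c $ \<sigma> \<noteq> 0" for \<sigma>
  proof -
    have "i ` \<sigma> \<in> (`) i ` K" "card (i ` \<sigma>) = Suc l"
      using that c' by (auto simp: c_def chains_def)
    then show ?thesis
      using i by (metis card_image image_iff inj_image_eq_iff inj_on_subset subset_UNIV)
  qed
  then have "c \<in> chains l K" by (simp add: chains_def)
  ultimately show "c' \<in> push_chain i ` chains l K" by (auto simp: vec_eq_iff)
qed

lemma inj_push_chain:
  assumes i: "inj i"
  shows "inj (push_chain i)"
proof (rule injI)
  fix c c' assume eq: "push_chain i c = push_chain i c'"
  have "push_chain i b $ (i ` \<sigma>) = b $ \<sigma>" for b \<sigma>
    using i by (auto simp: push_chain_def inj_vimage_image_eq)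
  then show "c = c'" using eq by (metis vec_eq_iff)
qed

lemma push_chain_cycles:
  assumes i: "inj i"
  shows "push_chain i ` cycles l K = cycles l ((`) i ` K)"
proof -
  have zero: "push_chain i 0 = 0" by (simp add: push_chain_def vec_eq_iff)
  have "boundary (push_chain i c) = 0 \<longleftrightarrow> boundary c = 0" for c
    using inj_push_chain[OF i] zero by (metis injD push_chain_boundary[OF i])
  then have "push_chain i ` {c \<in> chains l K. boundary c = 0}
      = {c \<in> push_chain i ` chains l K. boundary c = 0}" by auto
  then show ?thesis unfolding cycles_def push_chain_image[OF i] .
qed

lemma push_chain_boundaries:
  assumes i: "inj i"
  shows "push_chain i ` boundaries l K = boundaries l ((`) i ` K)"
  unfolding boundaries_def push_chain_image[OF i, symmetric] image_image
  by (simp add: push_chain_boundary[OF i])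

text \<open>An injective relabelling of vertices acts as an injective linear map on chains. This
  lets the complexes of one point cloud be studied inside the disjoint union of two.\<close>

lemma cycle_boundary_dim_image:
  fixes i :: "'v::finite \<Rightarrow> 'w::finite"
  assumes i: "inj i"
  shows "cycle_boundary_dim l ((`) i ` K) ((`) i ` L) = cycle_boundary_dim l K L"
proof -
  have "cycles l ((`) i ` K) \<inter> boundaries l ((`) i ` L) = push_chain i ` (cycles l K \<inter> boundaries l L)"
    unfolding push_chain_cycles[OF i, symmetric] push_chain_boundaries[OF i, symmetric]
    by (rule image_Int[OF inj_push_chain[OF i], symmetric])
  moreover have "Vector_Spaces.linear (*s) (*s) (push_chain i :: bit ^ ('v set) \<Rightarrow> bit ^ ('w set))"
    by (rule bit_linearI) (simp add: push_chain_def vec_eq_iff)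
  ultimately show ?thesis
    unfolding cycle_boundary_dim_def
    using vec.dim_image_eq inj_on_subset[OF inj_push_chain[OF i]] by (metis subset_UNIV)
qed

text \<open>Clique complexes are determined by edges and loops, so only those at \<open>p u\<close>
  have to be checked. The premise \<open>R u u\<close> is available because \<open>u\<close> already
  lies in a simplex.\<close>

lemma absorbs_flag:
  assumes "\<And>u j. u \<in> U \<Longrightarrow> R u j \<Longrightarrow> R u u \<Longrightarrow> R (p u) j \<and> R j (p u)"
    and "\<And>u. u \<in> U \<Longrightarrow> R u u \<Longrightarrow> R (p u) (p u)"
  shows "absorbs U p (flag R)"
  unfolding absorbs_def flag_def using assms by blast


lemma chains_support: "c \<in> chains l K \<Longrightarrow> c $ \<sigma> \<noteq> 0 \<Longrightarrow> \<sigma> \<in> K"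
  by (auto simp: chains_def)

text \<open>\<open>A\<close> and \<open>B\<close> are carried by the first and the second point cloud. In \<open>P\<close> the first cloud can be
  pushed onto the second one, in \<open>Q\<close> the second one onto the first.\<close>

lemma interleaving_dim:
  fixes p q :: "'v::finite \<Rightarrow> 'v"
  assumes p: "p ` U \<inter> U = {}" and q: "q ` V \<inter> V = {}"
    and T: "absorbs U p T" "absorbs V q T"
    and P: "absorbs U p P" and Q: "absorbs V q Q" and PQ: "P \<subseteq> Q"
    and A: "A \<subseteq> P" "A \<subseteq> A'" "A' \<subseteq> T" "{\<sigma>\<in>Q. \<sigma> \<inter> V = {}} \<subseteq> A'" "\<And>\<sigma>. \<sigma> \<in> A' \<Longrightarrow> \<sigma> \<inter> V = {}"
    and B: "{\<sigma>\<in>P. \<sigma> \<inter> U = {}} \<subseteq> B" "B \<subseteq> B'" "B' \<subseteq> Q" "{\<sigma>\<in>T. \<sigma> \<inter> U = {}} \<subseteq> TB" "B' \<subseteq> TB"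
    and TA: "A' \<subseteq> TA" "TA \<subseteq> T"
  shows "cycle_boundary_dim l A TA + cycle_boundary_dim l B B'
       \<le> cycle_boundary_dim l B TB + cycle_boundary_dim l A A'"
proof -
  obtain F where F: "chain_retraction U p F" using chain_retraction_exists[OF p] by blast
  obtain G where G: "chain_retraction V q G" using chain_retraction_exists[OF q] by blast
  note F' = chain_retractionD[OF F] and G' = chain_retractionD[OF G]
  have F0: "F 0 = 0" using F'(1)[of 0 0] by simp
  show ?thesis
    unfolding cycle_boundary_dim_def
  \<comment> \<open>\<open>F\<close> embeds the cycles of \<open>A\<close> that bound in
    \<open>TA\<close>, modulo those that bound in \<open>A'\<close>, into the corresponding quotient
    for \<open>B\<close>, \<open>TB\<close> and \<open>B'\<close>.\<close>
  proof (rule dim_quotient_mono[of F])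
    show "Vector_Spaces.linear (*s) (*s) F" by (rule bit_linearI) (rule F'(1))
    show "cycles l A \<inter> boundaries l A' \<subseteq> cycles l A \<inter> boundaries l TA"
      "cycles l B \<inter> boundaries l B' \<subseteq> cycles l B \<inter> boundaries l TB"
      using boundaries_mono TA(1) B(5) by blast+
    show "F z \<in> cycles l B \<inter> boundaries l TB" if z: "z \<in> cycles l A \<inter> boundaries l TA" for z
    proof
      have "z \<in> chains l P" using that A(1) chains_mono[of A P l] by (auto simp: cycles_def)
      then have "F z \<in> chains l B" using F'(4)[OF P] chains_mono[OF B(1)] by blast
      moreover have "boundary (F z) = 0" using that by (simp add: cycles_def F0 flip: F'(2))
      ultimately show "F z \<in> cycles l B" by (simp add: cycles_def)
      obtain c where c: "c \<in> chains (Suc l) TA" "z = boundary c"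
        using z unfolding boundaries_def by blast
      then have "c \<in> chains (Suc l) T" using TA(2) chains_mono by blast
      then have "F c \<in> chains (Suc l) TB" using F'(4)[OF T(1)] chains_mono[OF B(4)] by blast
      then show "F z \<in> boundaries l TB" using c F'(2) by (auto simp: boundaries_def)
    qed
    show "z \<in> cycles l A \<inter> boundaries l A'"
      if z: "z \<in> cycles l A \<inter> boundaries l TA" and Fz: "F z \<in> cycles l B \<inter> boundaries l B'" for z
    proof
      have "z \<in> cycles l P" using z cycles_mono[OF A(1)] by blast
      then have "z + F z \<in> boundaries l Q" using F'(5)[OF P] boundaries_mono[OF PQ] by blast
      moreover have "F z \<in> boundaries l Q" using Fz boundaries_mono[OF B(3)] by blast
      ultimately have "(z + F z) + F z \<in> boundaries l Q"
        by (rule vec.subspace_add[OF subspace_boundaries])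
      then obtain c where c: "c \<in> chains (Suc l) Q" "z = boundary c"
        by (auto simp: boundaries_def add.assoc)
      \<comment> \<open>\<open>z\<close> avoids the vertices of \<open>V\<close>, so pushing its
        filling \<open>c\<close> by \<open>G\<close> keeps the boundary \<open>z\<close> and lands
        in \<open>A'\<close>.\<close>
      have "G z = z"
        by (rule G'(3)) (use z A(2,5) in \<open>auto simp: cycles_def dest!: chains_support\<close>)
      then have "z = boundary (G c)" using c G'(2) by simp
      moreover have "G c \<in> chains (Suc l) A'" using G'(4)[OF Q] c chains_mono[OF A(4)] by blast
      ultimately show "z \<in> boundaries l A'" by (auto simp: boundaries_def)
    qed (use z in blast)
  qed (rule vec.subspace_inter[OF subspace_cycles subspace_boundaries])+
qed

lemma image_flag:
  assumes "inj i"
  shows "(`) i ` flag (\<lambda>a b. R (i a) (i b)) = {\<sigma>\<in>flag R. \<sigma> \<subseteq> range i}"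
proof (intro equalityI subsetI)
  fix \<tau> assume "\<tau> \<in> {\<sigma>\<in>flag R. \<sigma> \<subseteq> range i}"
  then have \<tau>: "\<tau> \<in> flag R" "\<tau> = i ` (i -` \<tau>)" by auto
  then have "i -` \<tau> \<in> flag (\<lambda>a b. R (i a) (i b))"
    unfolding flag_def by fastforce
  then show "\<tau> \<in> (`) i ` flag (\<lambda>a b. R (i a) (i b))" using \<tau> by blast
qed (auto simp: flag_def)

section \<open>Rips complexes and the Hausdorff distance\<close>

lemma vr_filtration_le_iff:
  fixes x :: "'a::euclidean_space ^ 'n::finite"
  assumes "\<sigma> \<noteq> {}"
  shows "vr_filtration x \<sigma> \<le> a \<longleftrightarrow> (\<forall>i\<in>\<sigma>. \<forall>j\<in>\<sigma>. norm (x $ i - x $ j) \<le> a)"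
  unfolding vr_filtration_def by (subst Max_le_iff) (use assms in auto)

lemma vr_filtration_less_iff:
  fixes x :: "'a::euclidean_space ^ 'n::finite"
  assumes "\<sigma> \<noteq> {}"
  shows "vr_filtration x \<sigma> < a \<longleftrightarrow> (\<forall>i\<in>\<sigma>. \<forall>j\<in>\<sigma>. norm (x $ i - x $ j) < a)"
  unfolding vr_filtration_def by (subst Max_less_iff) (use assms in auto)

lemma sublevel_vr: "sublevel (vr_filtration x) (ereal a) = flag (\<lambda>i j. norm (x $ i - x $ j) \<le> a)"
  unfolding sublevel_def flag_def by (rule Collect_cong, rule conj_cong) (simp_all add: vr_filtration_le_iff)

lemma strict_sublevel_vr:
  "strict_sublevel (vr_filtration x) (ereal a) = flag (\<lambda>i j. norm (x $ i - x $ j) < a)"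
  unfolding strict_sublevel_def flag_def by (rule Collect_cong, rule conj_cong) (simp_all add: vr_filtration_less_iff)

lemma hausdorff_config_match:
  fixes x y :: "'a::euclidean_space ^ 'n::finite"
  shows "\<exists>j. norm (x $ i - y $ j) \<le> hausdorff_config x y"
    and "\<exists>i. norm (x $ i - y $ j) \<le> hausdorff_config x y"
proof -
  have "(MIN j. norm (x $ i - y $ j)) \<in> range (\<lambda>j. norm (x $ i - y $ j))"
    by (rule Min_in) auto
  moreover have "(MIN j. norm (x $ i - y $ j)) \<le> (MAX i. MIN j. norm (x $ i - y $ j))"
    by (rule Max_ge) auto
  ultimately show "\<exists>j. norm (x $ i - y $ j) \<le> hausdorff_config x y"
    unfolding hausdorff_config_def by (metis (no_types, lifting) imageE max.coboundedI1)
  have "(MIN i. norm (x $ i - y $ j)) \<in> range (\<lambda>i. norm (x $ i - y $ j))"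
    by (rule Min_in) auto
  moreover have "(MIN i. norm (x $ i - y $ j)) \<le> (MAX j. MIN i. norm (x $ i - y $ j))"
    by (rule Max_ge) auto
  ultimately show "\<exists>i. norm (x $ i - y $ j) \<le> hausdorff_config x y"
    unfolding hausdorff_config_def by (metis (no_types, lifting) imageE max.coboundedI2)
qed

lemma hausdorff_config_nonneg: "0 \<le> hausdorff_config x y"
  using hausdorff_config_match(1) norm_ge_zero order_trans by blast

lemma hausdorff_config_commute: "hausdorff_config x y = hausdorff_config y x"
  unfolding hausdorff_config_def by (simp add: norm_minus_commute max.commute)

text \<open>Both clouds are placed on the disjoint union of their index sets, where nearest-point
  maps feed \<open>interleaving_dim\<close>. With the terms rearranged, each side becomes a count of
  finite pairs as in \<open>count_finite_pairs\<close>.\<close>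

lemma vr_interleaving:
  fixes x y :: "'a::euclidean_space ^ 'n::finite"
  defines "\<epsilon> \<equiv> hausdorff_config x y"
  assumes ac: "a + 2 * \<epsilon> < c - 2 * \<epsilon>"
  shows "cycle_boundary_dim l (flag (\<lambda>i j. norm (x $ i - x $ j) \<le> a)) {\<sigma>. \<sigma> \<noteq> {}}
       + cycle_boundary_dim l (flag (\<lambda>i j. norm (y $ i - y $ j) \<le> a + 2 * \<epsilon>)) (flag (\<lambda>i j. norm (y $ i - y $ j) < c - 2 * \<epsilon>))
       \<le> cycle_boundary_dim l (flag (\<lambda>i j. norm (y $ i - y $ j) \<le> a + 2 * \<epsilon>)) {\<sigma>. \<sigma> \<noteq> {}}
       + cycle_boundary_dim l (flag (\<lambda>i j. norm (x $ i - x $ j) \<le> a)) (flag (\<lambda>i j. norm (x $ i - x $ j) < c))"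
proof -
  define z :: "'n + 'n \<Rightarrow> 'a" where "z = case_sum (($) x) (($) y)"
  define U :: "('n + 'n) set" where "U = range Inl"
  define V :: "('n + 'n) set" where "V = range Inr"
  have "\<forall>i. \<exists>j. norm (x $ i - y $ j) \<le> \<epsilon>" "\<forall>j. \<exists>i. norm (x $ i - y $ j) \<le> \<epsilon>"
    unfolding \<epsilon>_def using hausdorff_config_match by blast+
  then obtain f g where f: "\<And>i. norm (x $ i - y $ f i) \<le> \<epsilon>" and g: "\<And>j. norm (x $ g j - y $ j) \<le> \<epsilon>"
    by metis
  define p :: "'n + 'n \<Rightarrow> 'n + 'n" where "p = case_sum (Inr \<circ> f) Inr"
  define q :: "'n + 'n \<Rightarrow> 'n + 'n" where "q = case_sum Inl (Inl \<circ> g)"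
  have p_close: "norm (z u - z (p u)) \<le> \<epsilon>" "p u \<in> V" if "u \<in> U" for u
    using that f by (auto simp: U_def V_def p_def z_def)
  have q_close: "norm (z u - z (q u)) \<le> \<epsilon>" "q u \<in> U" if "u \<in> V" for u
    using that g by (auto simp: U_def V_def q_def z_def norm_minus_commute)
  have UV: "U \<inter> V = {}" "U \<union> V = UNIV" by (auto simp: U_def V_def UNIV_sum)
  have \<epsilon>: "0 \<le> \<epsilon>" unfolding \<epsilon>_def by (rule hausdorff_config_nonneg)
  \<comment> \<open>Vertices in \<open>W\<close> get an allowance \<open>\<epsilon>\<close> in the
    edge thresholds: those of the second cloud in \<open>P\<close>, those of the first in
    \<open>Q\<close>. Moving a vertex to a nearest point lengthens its edges by at most
    \<open>\<epsilon>\<close> and gains just this allowance.\<close>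
  define e where "e W i = (if i \<in> W then \<epsilon> else 0)" for W :: "('n + 'n) set" and i
  have e: "0 \<le> e W i" "e W i \<le> \<epsilon>" "i \<in> W \<Longrightarrow> e W i = \<epsilon>" "i \<notin> W \<Longrightarrow> e W i = 0" for W i
    using \<epsilon> by (auto simp: e_def)
  have UV': "u \<notin> V" if "u \<in> U" for u using that UV by blast
  have VU': "u \<notin> U" if "u \<in> V" for u using that UV by blast
  have tri: "norm (z w - z j) \<le> norm (z u - z j) + norm (z u - z w)" for u w j
    using norm_triangle_ineq4[of "z u - z j" "z u - z w"] by simp
  define P where "P = flag (\<lambda>i j. norm (z i - z j) \<le> a + e V i + e V j)"
  define Q where "Q = flag (\<lambda>i j. norm (z i - z j) < (c - 2 * \<epsilon>) + e U i + e U j)"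
  let ?T = "{\<sigma>. \<sigma> \<noteq> {}} :: ('n + 'n) set set"
  define A where "A = {\<sigma>\<in>flag (\<lambda>i j. norm (z i - z j) \<le> a). \<sigma> \<subseteq> U}"
  define A' where "A' = {\<sigma>\<in>flag (\<lambda>i j. norm (z i - z j) < c). \<sigma> \<subseteq> U}"
  define TA where "TA = {\<sigma>\<in>?T. \<sigma> \<subseteq> U}"
  define B where "B = {\<sigma>\<in>flag (\<lambda>i j. norm (z i - z j) \<le> a + 2 * \<epsilon>). \<sigma> \<subseteq> V}"
  define B' where "B' = {\<sigma>\<in>flag (\<lambda>i j. norm (z i - z j) < c - 2 * \<epsilon>). \<sigma> \<subseteq> V}"
  define TB where "TB = {\<sigma>\<in>?T. \<sigma> \<subseteq> V}"
  have disjU: "\<sigma> \<inter> U = {} \<longleftrightarrow> \<sigma> \<subseteq> V" and disjV: "\<sigma> \<inter> V = {} \<longleftrightarrow> \<sigma> \<subseteq> U" for \<sigma>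
    using UV by blast+
  have "cycle_boundary_dim l A TA + cycle_boundary_dim l B B'
       \<le> cycle_boundary_dim l B TB + cycle_boundary_dim l A A'"
  proof (rule interleaving_dim[where p=p and q=q and T = ?T and P=P and Q=Q and U=U and V=V])
    show "p ` U \<inter> U = {}" "q ` V \<inter> V = {}" using p_close(2) q_close(2) UV by blast+
    show "absorbs U p ?T" "absorbs V q ?T" by (auto simp: absorbs_def)
    show "absorbs U p P" unfolding P_def
    proof (rule absorbs_flag)
      fix u j assume u: "u \<in> U" and uj: "norm (z u - z j) \<le> a + e V u + e V j"
      have "norm (z (p u) - z j) \<le> a + e V (p u) + e V j"
        using tri[where u=u and w="p u" and j=j] p_close[OF u] uj e(4)[of u V] e(3)[of "p u" V] UV'[OF u] by linarith
      then show "norm (z (p u) - z j) \<le> a + e V (p u) + e V j \<and> norm (z j - z (p u)) \<le> a + e V j + e V (p u)"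
        by (simp add: norm_minus_commute algebra_simps)
    next
      fix u assume u: "u \<in> U" and uj: "norm (z u - z u) \<le> a + e V u + e V u"
      then show "norm (z (p u) - z (p u)) \<le> a + e V (p u) + e V (p u)"
        using e(4)[of u V] e(1)[of V "p u"] UV'[OF u] by simp
    qed
    show "absorbs V q Q" unfolding Q_def
    proof (rule absorbs_flag)
      fix u j assume u: "u \<in> V" and uj: "norm (z u - z j) < (c - 2 * \<epsilon>) + e U u + e U j"
      have "norm (z (q u) - z j) < (c - 2 * \<epsilon>) + e U (q u) + e U j"
        using tri[where u=u and w="q u" and j=j] q_close[OF u] uj e(4)[of u U] e(3)[of "q u" U] VU'[OF u] by linarith
      then show "norm (z (q u) - z j) < (c - 2 * \<epsilon>) + e U (q u) + e U j \<and> norm (z j - z (q u)) < (c - 2 * \<epsilon>) + e U j + e U (q u)"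
        by (simp add: norm_minus_commute algebra_simps)
    next
      fix u assume u: "u \<in> V" and uj: "norm (z u - z u) < (c - 2 * \<epsilon>) + e U u + e U u"
      then show "norm (z (q u) - z (q u)) < (c - 2 * \<epsilon>) + e U (q u) + e U (q u)"
        using e(4)[of u U] e(1)[of U "q u"] VU'[OF u] by simp
    qed
    \<comment> \<open>The allowances in \<open>P\<close> add up to at most
      \<open>2 * \<epsilon>\<close>, which the gap \<open>ac\<close> absorbs.\<close>
    have "norm (z i - z j) < (c - 2 * \<epsilon>) + e U i + e U j"
      if "norm (z i - z j) \<le> a + e V i + e V j" for i j
      using that ac e(1)[of U i] e(1)[of U j] e(2)[of V i] e(2)[of V j] by linarith
    then show "P \<subseteq> Q" unfolding P_def Q_def flag_def by blast
    have "norm (z i - z j) \<le> a + e V i + e V j" if "norm (z i - z j) \<le> a" for i j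
      using that e(1)[of V i] e(1)[of V j] by linarith
    then show "A \<subseteq> P" unfolding A_def P_def flag_def by blast
    have "norm (z i - z j) < c" if "norm (z i - z j) \<le> a" for i j
      using that ac \<epsilon> by linarith
    then show "A \<subseteq> A'" unfolding A_def A'_def flag_def by blast
    show "A' \<subseteq> ?T" "A' \<subseteq> TA" "TA \<subseteq> ?T" "B' \<subseteq> TB" by (auto simp: A'_def TA_def B'_def TB_def flag_def)
    have "norm (z i - z j) < c" if "norm (z i - z j) < (c - 2 * \<epsilon>) + e U i + e U j" for i j
      using that e(2)[of U i] e(2)[of U j] by linarith
    then show "{\<sigma> \<in> Q. \<sigma> \<inter> V = {}} \<subseteq> A'" unfolding A'_def Q_def flag_def disjV by blast
    show "\<sigma> \<inter> V = {}" if "\<sigma> \<in> A'" for \<sigma> using that by (simp add: A'_def disjV)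
    have "norm (z i - z j) \<le> a + 2 * \<epsilon>" if "norm (z i - z j) \<le> a + e V i + e V j" for i j
      using that e(2)[of V i] e(2)[of V j] by linarith
    then show "{\<sigma> \<in> P. \<sigma> \<inter> U = {}} \<subseteq> B" unfolding B_def P_def flag_def disjU by blast
    have "norm (z i - z j) < c - 2 * \<epsilon>" if "norm (z i - z j) \<le> a + 2 * \<epsilon>" for i j
      using that ac by linarith
    then show "B \<subseteq> B'" unfolding B_def B'_def flag_def by blast
    have "norm (z i - z j) < (c - 2 * \<epsilon>) + e U i + e U j" if "norm (z i - z j) < c - 2 * \<epsilon>" for i j
      using that e(1)[of U i] e(1)[of U j] by linarith
    then show "B' \<subseteq> Q" unfolding B'_def Q_def flag_def by blast
    show "{\<sigma> \<in> ?T. \<sigma> \<inter> U = {}} \<subseteq> TB" by (simp add: TB_def disjU)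
  qed
  moreover have "A = (`) Inl ` flag (\<lambda>i j. norm (x $ i - x $ j) \<le> a)"
      "A' = (`) Inl ` flag (\<lambda>i j. norm (x $ i - x $ j) < c)"
      "B = (`) Inr ` flag (\<lambda>i j. norm (y $ i - y $ j) \<le> a + 2 * \<epsilon>)"
      "B' = (`) Inr ` flag (\<lambda>i j. norm (y $ i - y $ j) < c - 2 * \<epsilon>)"
    unfolding A_def A'_def B_def B'_def U_def V_def
    by (simp_all flip: image_flag add: z_def)
  moreover have "TA = (`) Inl ` {\<sigma>. \<sigma> \<noteq> {}}" "TB = (`) Inr ` {\<sigma>. \<sigma> \<noteq> {}}"
    by (auto simp: TA_def TB_def U_def V_def subset_image_iff)
  ultimately show ?thesis
    by (simp add: cycle_boundary_dim_image)
qed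

subsection \<open>Counting finite pairs\<close>

text \<open>The subtracted dimension is that of a subspace, so the truncated subtraction is
  exact.\<close>

lemma persistent_betti_eq:
  "int (persistent_betti l K L) = int (vec.dim (cycles l K)) - int (cycle_boundary_dim l K L)"
proof -
  have "vec.dim (cycles l K \<inter> boundaries l L) \<le> vec.dim (cycles l K)"
    by (rule vec.dim_subset) blast
  then show ?thesis by (simp add: persistent_betti_def cycle_boundary_dim_def)
qed

text \<open>The dimensions of the cycle spaces cancel in the alternating sum, which leaves the other
  terms with reversed signs.\<close>

lemma multiplicity_pd_ereal:
  "multiplicity_pd l f b (ereal d) =
     int (cycle_boundary_dim l (sublevel f b) (sublevel f d))
   - int (cycle_boundary_dim l (sublevel f b) (strict_sublevel f d))
   - int (cycle_boundary_dim l (strict_sublevel f b) (sublevel f d))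
   + int (cycle_boundary_dim l (strict_sublevel f b) (strict_sublevel f d))"
  by (simp add: multiplicity_pd_def persistent_betti_eq)

text \<open>The two mixed subspaces intersect in the smallest one and their sum lies in the largest
  one.\<close>

lemma cycle_boundary_dim_supermodular:
  assumes K: "K0 \<subseteq> K" and L: "L0 \<subseteq> L"
  shows "cycle_boundary_dim l K L0 + cycle_boundary_dim l K0 L
       \<le> cycle_boundary_dim l K L + cycle_boundary_dim l K0 L0"
proof -
  define A where "A = cycles l K \<inter> boundaries l L0"
  define B where "B = cycles l K0 \<inter> boundaries l L"
  have sub: "vec.subspace (cycles l C \<inter> boundaries l D)" for C D :: "'a set set"
    by (rule vec.subspace_inter[OF subspace_cycles subspace_boundaries])
  have "A \<inter> B = cycles l K0 \<inter> boundaries l L0"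
    unfolding A_def B_def using cycles_mono[OF K] boundaries_mono[OF L] by blast
  moreover have "{x + y |x y. x \<in> A \<and> y \<in> B} \<subseteq> cycles l K \<inter> boundaries l L"
  proof clarify
    fix x y assume "x \<in> A" "y \<in> B"
    then have "x \<in> cycles l K \<inter> boundaries l L" "y \<in> cycles l K \<inter> boundaries l L"
      unfolding A_def B_def using cycles_mono[OF K] boundaries_mono[OF L] by blast+
    then show "x + y \<in> cycles l K \<inter> boundaries l L"
      by (rule vec.subspace_add[OF sub])
  qed
  then have "vec.dim {x + y |x y. x \<in> A \<and> y \<in> B} \<le> vec.dim (cycles l K \<inter> boundaries l L)"
    by (rule vec.dim_subset)
  moreover have "vec.dim {x + y |x y. x \<in> A \<and> y \<in> B} + vec.dim (A \<inter> B) = vec.dim A + vec.dim B"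
    by (rule vec.dim_sums_Int) (simp_all add: A_def B_def sub)
  ultimately show ?thesis
    unfolding cycle_boundary_dim_def A_def[symmetric] B_def[symmetric] by (simp del: vec.dim_eq_0)
qed

text \<open>Hence \<open>nat\<close> in \<open>persistence_diagram\<close> truncates nothing at
  finite deaths, and multiplicities can be summed as integers.\<close>

lemma multiplicity_pd_nonneg: "0 \<le> multiplicity_pd l f b (ereal d)"
proof -
  have "strict_sublevel f b \<subseteq> sublevel f b" "strict_sublevel f d \<subseteq> sublevel f d"
    by (auto simp: sublevel_def strict_sublevel_def)
  from cycle_boundary_dim_supermodular[OF this, of l] show ?thesis
    unfolding multiplicity_pd_ereal by linarith
qed

lemma cycle_boundary_dim_empty [simp]: "cycle_boundary_dim l {} L = 0"
proof -
  have "cycles l ({} :: 'a set set) \<subseteq> {0}" by (auto simp: cycles_def chains_def vec_eq_iff)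
  then show ?thesis unfolding cycle_boundary_dim_def vec.dim_eq_0 by blast
qed

text \<open>The elements of \<open>A\<close> are added to the initial part \<open>P\<close> in
  increasing order, and the increments of \<open>g\<close> telescope; the induction removes the
  maximum of \<open>A\<close>.\<close>

lemma sum_telescope_upset:
  fixes g :: "'a::linorder set \<Rightarrow> int"
  assumes "finite A" and "\<And>p a. p \<in> P \<Longrightarrow> a \<in> A \<Longrightarrow> p < a"
  shows "(\<Sum>d\<in>A. g ((P \<union> A) \<inter> {..d}) - g ((P \<union> A) \<inter> {..<d})) = g (P \<union> A) - g P"
  using assms
proof (induction A rule: finite_linorder_max_induct)
  case (insert m A)
  have 1: "(P \<union> insert m A) \<inter> {..m} = P \<union> insert m A" "(P \<union> insert m A) \<inter> {..<m} = P \<union> A"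
    using insert by (auto simp: less_imp_le)
  have 2: "(P \<union> insert m A) \<inter> {..d} = (P \<union> A) \<inter> {..d}" "(P \<union> insert m A) \<inter> {..<d} = (P \<union> A) \<inter> {..<d}"
    if "d \<in> A" for d
    using insert.hyps(2) that by force+
  have "m \<notin> A" using insert.hyps(2) by blast
  have "(\<Sum>d\<in>A. g ((P \<union> insert m A) \<inter> {..d}) - g ((P \<union> insert m A) \<inter> {..<d}))
      = (\<Sum>d\<in>A. g ((P \<union> A) \<inter> {..d}) - g ((P \<union> A) \<inter> {..<d}))"
    by (rule sum.cong[OF refl]) (simp only: 2)
  also have "\<dots> = g (P \<union> A) - g P"
    using insert by blast
  finally show ?case
    unfolding sum.insert[OF insert.hyps(1) \<open>m \<notin> A\<close>] 1 by simp
qed simp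

lemma size_filter_sum_mset:
  "finite A \<Longrightarrow> size (filter_mset R (\<Sum>x\<in>A. g x)) = (\<Sum>x\<in>A. size (filter_mset R (g x)))"
  by (induction A rule: finite_induct) auto

lemma size_filter_replicate_mset:
  "size (filter_mset R (replicate_mset n x)) = (if R x then n else 0)"
  by (induction n) auto

text \<open>Multiplicities are mixed second differences, so summing them over a rectangle of births
  and deaths leaves only corner terms.\<close>

lemma count_finite_pairs:
  fixes f :: "'v::finite set \<Rightarrow> real"
  assumes ac: "a < c"
  shows "int (size {#p \<in># finite_pairs (persistence_diagram l f). fst p \<le> a \<and> c \<le> snd p#})
       = int (cycle_boundary_dim l (sublevel f a) {\<sigma>. \<sigma> \<noteq> {}})
       - int (cycle_boundary_dim l (sublevel f a) (strict_sublevel f c))"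
proof -
  define V where "V = f ` {\<sigma>. \<sigma> \<noteq> {}}"
  have finV: "finite V" by (simp add: V_def)
  define Grid where "Grid = {(b, d). b \<in> f ` {\<sigma>. \<sigma> \<noteq> {}} \<and>
      d \<in> insert \<infinity> ((\<lambda>\<sigma>. ereal (f \<sigma>)) ` {\<sigma>. \<sigma> \<noteq> {}}) \<and> ereal b < d}"
  have "Grid \<subseteq> V \<times> insert \<infinity> (ereal ` V)" by (auto simp: Grid_def V_def)
  then have finG: "finite Grid" using finV finite_subset by blast
  define R where "R p \<longleftrightarrow> snd p < \<infinity> \<and> fst p \<le> a \<and> c \<le> real_of_ereal (snd p)" for p :: "real \<times> ereal"
  \<comment> \<open>Indexing complexes by sets of values turns sublevel and strict sublevel
    complexes into initial segments of \<open>V\<close>, as the telescoping requires.\<close>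
  define X where "X S = {\<sigma>. \<sigma> \<noteq> {} \<and> f \<sigma> \<in> S}" for S
  define g where "g S T = int (cycle_boundary_dim l (X S) (X T))" for S T
  have X: "sublevel f (ereal b) = X (V \<inter> {..b})" "strict_sublevel f (ereal b) = X (V \<inter> {..<b})" for b
    by (auto simp: sublevel_def strict_sublevel_def X_def V_def)
  have XV: "X V = {\<sigma>. \<sigma> \<noteq> {}}" "X {} = {}" by (auto simp: X_def V_def)
  have "int (size {#p \<in># finite_pairs (persistence_diagram l f). fst p \<le> a \<and> c \<le> snd p#})
      = int (size (filter_mset R (persistence_diagram l f)))"
    unfolding finite_pairs_def R_def
    by (simp add: filter_mset_image_mset filter_filter_mset case_prod_unfold conj_commute)
  also have "\<dots> = (\<Sum>p\<in>Grid. if R p then int (nat (multiplicity_pd l f (fst p) (snd p))) else 0)"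
    unfolding persistence_diagram_def Grid_def[symmetric] size_filter_sum_mset[OF finG]
    by (auto simp: size_filter_replicate_mset case_prod_unfold intro!: sum.cong)
  also have "\<dots> = (\<Sum>p\<in>{p\<in>Grid. R p}. int (nat (multiplicity_pd l f (fst p) (snd p))))"
    using finG by (simp add: sum.If_cases Int_def)
  \<comment> \<open>\<open>R\<close> discards infinite deaths, and \<open>a < c\<close> makes the
    grid condition \<open>b < d\<close> automatic, so a product remains.\<close>
  also have "{p\<in>Grid. R p} = (\<lambda>(b, d). (b, ereal d)) ` ((V \<inter> {..a}) \<times> (V \<inter> {c..}))"
    using ac by (auto simp: Grid_def R_def V_def image_iff)
  also have "(\<Sum>p\<in>\<dots>. int (nat (multiplicity_pd l f (fst p) (snd p))))
      = (\<Sum>(b, d)\<in>(V \<inter> {..a}) \<times> (V \<inter> {c..}). multiplicity_pd l f b (ereal d))"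
    by (subst sum.reindex) (auto simp: inj_on_def multiplicity_pd_nonneg intro!: sum.cong)
  also have "\<dots> = (\<Sum>b\<in>V \<inter> {..a}. \<Sum>d\<in>V \<inter> {c..}.
      (g (V \<inter> {..b}) (V \<inter> {..d}) - g (V \<inter> {..<b}) (V \<inter> {..d}))
    - (g (V \<inter> {..b}) (V \<inter> {..<d}) - g (V \<inter> {..<b}) (V \<inter> {..<d})))"
    by (simp add: sum.cartesian_product[symmetric] multiplicity_pd_ereal X g_def algebra_simps)
  \<comment> \<open>The sum over deaths telescopes from the values below \<open>c\<close> up to all
    of \<open>V\<close>.\<close>
  also have "\<dots> = (\<Sum>b\<in>V \<inter> {..a}. (g (V \<inter> {..b}) V - g (V \<inter> {..<b}) V)
      - (g (V \<inter> {..b}) (V \<inter> {..<c}) - g (V \<inter> {..<b}) (V \<inter> {..<c})))"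
  proof (rule sum.cong[OF refl])
    fix b
    have "V \<inter> {..<c} \<union> V \<inter> {c..} = V" by auto
    with sum_telescope_upset[of "V \<inter> {c..}" "V \<inter> {..<c}"
        "\<lambda>T. g (V \<inter> {..b}) T - g (V \<inter> {..<b}) T"] finV
    show "(\<Sum>d\<in>V \<inter> {c..}.
        (g (V \<inter> {..b}) (V \<inter> {..d}) - g (V \<inter> {..<b}) (V \<inter> {..d}))
      - (g (V \<inter> {..b}) (V \<inter> {..<d}) - g (V \<inter> {..<b}) (V \<inter> {..<d})))
      = (g (V \<inter> {..b}) V - g (V \<inter> {..<b}) V)
      - (g (V \<inter> {..b}) (V \<inter> {..<c}) - g (V \<inter> {..<b}) (V \<inter> {..<c}))"
      by auto
  qed
  \<comment> \<open>Births are at most \<open>a\<close>, so the extra intersection changes nothing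
    and gives the shape for telescoping over births.\<close>
  also have "\<dots> = (\<Sum>b\<in>V \<inter> {..a}.
      (g (V \<inter> {..a} \<inter> {..b}) V - g (V \<inter> {..a} \<inter> {..b}) (V \<inter> {..<c}))
    - (g (V \<inter> {..a} \<inter> {..<b}) V - g (V \<inter> {..a} \<inter> {..<b}) (V \<inter> {..<c})))"
  proof (rule sum.cong[OF refl])
    fix b assume "b \<in> V \<inter> {..a}"
    then have "V \<inter> {..a} \<inter> {..b} = V \<inter> {..b}" "V \<inter> {..a} \<inter> {..<b} = V \<inter> {..<b}" by auto
    then show "(g (V \<inter> {..b}) V - g (V \<inter> {..<b}) V)
      - (g (V \<inter> {..b}) (V \<inter> {..<c}) - g (V \<inter> {..<b}) (V \<inter> {..<c}))
      = (g (V \<inter> {..a} \<inter> {..b}) V - g (V \<inter> {..a} \<inter> {..b}) (V \<inter> {..<c}))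
    - (g (V \<inter> {..a} \<inter> {..<b}) V - g (V \<inter> {..a} \<inter> {..<b}) (V \<inter> {..<c}))" by simp
  qed
  \<comment> \<open>The births start at the empty complex, whose terms vanish by
    \<open>cycle_boundary_dim_empty\<close>.\<close>
  also have "\<dots> = (g (V \<inter> {..a}) V - g (V \<inter> {..a}) (V \<inter> {..<c})) - (g {} V - g {} (V \<inter> {..<c}))"
    using sum_telescope_upset[of "V \<inter> {..a}" "{}" "\<lambda>T. g T V - g T (V \<inter> {..<c})"] finV by simp
  finally show ?thesis
    by (simp add: g_def X XV)
qed

lemma vr_count_stability:
  fixes x y :: "'a::euclidean_space ^ 'n::finite"
  defines "\<epsilon> \<equiv> hausdorff_config x y"
  assumes ac: "a + 2 * \<epsilon> < c - 2 * \<epsilon>"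
  shows "size {#p \<in># finite_pairs (vr_diagram l x). fst p \<le> a \<and> c \<le> snd p#}
       \<le> size {#p \<in># finite_pairs (vr_diagram l y). fst p \<le> a + 2 * \<epsilon> \<and> c - 2 * \<epsilon> \<le> snd p#}"
proof -
  have "a < c" using ac hausdorff_config_nonneg[of x y] unfolding \<epsilon>_def by linarith
  from count_finite_pairs[OF this, of l "vr_filtration x"]
    count_finite_pairs[OF ac, of l "vr_filtration y"]
    vr_interleaving[OF ac[unfolded \<epsilon>_def], of l, folded \<epsilon>_def]
  show ?thesis
    unfolding vr_diagram_def sublevel_vr strict_sublevel_vr by linarith
qed

subsection \<open>Persistence landscapes\<close>

definition nth_largest :: "nat \<Rightarrow> real multiset \<Rightarrow> real" where
  "nth_largest m A =
     (let vs = rev (sorted_list_of_multiset A) in if m \<le> length vs then vs ! (m - 1) else 0)"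

text \<open>The entries that are at least \<open>v\<close> form an initial segment; positions start
  at 0, hence the strict inequality.\<close>

lemma descending_nth_ge_iff:
  fixes vs :: "'a::linorder list"
  assumes "sorted_wrt (\<ge>) vs" and "k < length vs"
  shows "v \<le> vs ! k \<longleftrightarrow> k < length (filter ((\<le>) v) vs)"
  using assms
proof (induction vs arbitrary: k)
  case (Cons x xs)
  show ?case
  proof (cases "v \<le> x")
    case True
    then show ?thesis using Cons by (cases k) auto
  next
    case False
    moreover have "\<not> v \<le> z" if "z \<in> set xs" for z
      using False Cons.prems(1) that by force
    ultimately have "filter ((\<le>) v) (x # xs) = []"
      by (simp add: filter_empty_conv)
    moreover have "(x # xs) ! k \<le> x"
      using Cons.prems by (cases k) auto
    ultimately show ?thesis using False by auto
  qed
qed simp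

text \<open>Since \<open>v\<close> is positive, the default 0 of a missing entry agrees with a count
  below \<open>m\<close>.\<close>

lemma nth_largest_ge_iff:
  assumes "0 < v" and "1 \<le> m"
  shows "v \<le> nth_largest m A \<longleftrightarrow> m \<le> size {#x \<in># A. v \<le> x#}"
proof -
  define vs where "vs = rev (sorted_list_of_multiset A)"
  have A: "mset vs = A" by (simp add: vs_def)
  have sorted: "sorted_wrt (\<ge>) vs"
    by (simp add: vs_def sorted_wrt_rev)
  have size: "size {#x \<in># A. v \<le> x#} = length (filter ((\<le>) v) vs)"
    unfolding A[symmetric] by (metis mset_filter size_mset)
  show ?thesis
  proof (cases "m \<le> length vs")
    case True
    then have "nth_largest m A = vs ! (m - 1)"
      by (simp add: nth_largest_def vs_def)
    with descending_nth_ge_iff[OF sorted, of "m - 1" v] True assms(2) size show ?thesis by auto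
  next
    case False
    then have "nth_largest m A = 0" by (simp add: nth_largest_def vs_def)
    moreover have "length (filter ((\<le>) v) vs) \<le> length vs" by (rule length_filter_le)
    ultimately show ?thesis using False assms size by linarith
  qed
qed

lemma nth_largest_cases: "nth_largest m A = 0 \<or> m = 0 \<or> nth_largest m A \<in># A"
proof -
  define vs where "vs = rev (sorted_list_of_multiset A)"
  have A: "set vs = set_mset A" by (simp add: vs_def)
  show ?thesis
    unfolding nth_largest_def vs_def[symmetric] Let_def
    by (cases m) (auto simp: nth_mem simp flip: A)
qed

lemma nth_largest_nonneg:
  assumes "\<And>x. x \<in># A \<Longrightarrow> 0 \<le> x" and "1 \<le> m"
  shows "0 \<le> nth_largest m A"
  using nth_largest_cases[of m A] assms by auto

lemma nth_largest_le:
  assumes "\<And>x. x \<in># A \<Longrightarrow> x \<le> u" and "0 \<le> u" and "1 \<le> m"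
  shows "nth_largest m A \<le> u"
  using nth_largest_cases[of m A] assms by auto

text \<open>Comparing counts at all levels compares order statistics. Positive levels are enough
  because the entries of \<open>B\<close> are nonnegative.\<close>

lemma nth_largest_shift:
  assumes count: "\<And>h. 0 < h \<Longrightarrow> size {#x \<in># A. h + \<delta> \<le> x#} \<le> size {#x \<in># B. h \<le> x#}"
    and B: "\<And>x. x \<in># B \<Longrightarrow> 0 \<le> x" and \<delta>: "0 \<le> \<delta>" and m: "1 \<le> m"
  shows "nth_largest m A \<le> nth_largest m B + \<delta>"
proof (rule ccontr)
  \<comment> \<open>At this level \<open>h + \<delta>\<close> is the order statistic of
    \<open>A\<close> itself, so \<open>A\<close> has at least \<open>m\<close> entries
    there.\<close>
  define h where "h = nth_largest m A - \<delta>"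
  assume "\<not> ?thesis"
  then have h: "nth_largest m B < h" by (simp add: h_def)
  have "0 \<le> nth_largest m B" using B m by (rule nth_largest_nonneg)
  with h have "0 < h" by linarith
  then have "m \<le> size {#x \<in># A. h + \<delta> \<le> x#}"
    using nth_largest_ge_iff[of "h + \<delta>" m A] \<delta> m by (simp add: h_def)
  also have "\<dots> \<le> size {#x \<in># B. h \<le> x#}" by (rule count[OF \<open>0 < h\<close>])
  finally have "h \<le> nth_largest m B"
    using nth_largest_ge_iff[OF \<open>0 < h\<close> m] by blast
  with h show False by linarith
qed

section \<open>Tents and landscapes\<close>

lemma landscape_eq_nth_largest:
  "landscape m D t = nth_largest m (image_mset (\<lambda>p. tent p t) (finite_pairs D))"
  by (simp add: landscape_def nth_largest_def Let_def)

text \<open>Where it is positive, the tent is the minimum of \<open>t - b\<close> and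
  \<open>d - t\<close>; \<open>0 < h\<close> excludes the region where it is extended by
  zero.\<close>

lemma tent_ge_iff:
  assumes "fst p < snd p" and "0 < h"
  shows "h \<le> tent p t \<longleftrightarrow> fst p \<le> t - h \<and> t + h \<le> snd p"
  using assms by (auto simp: tent_def field_simps split: prod.splits)

lemma tent_nonneg: "0 \<le> tent p t"
  by (auto simp: tent_def split: prod.splits)

lemma finite_pairs_withinD:
  assumes "finite_pairs_within S D" and "p \<in># finite_pairs D"
  shows "0 \<le> fst p" "fst p < snd p" "snd p \<le> S"
  using assms unfolding finite_pairs_within_def by (cases p; fastforce)+

lemma size_tent_ge:
  assumes D: "finite_pairs_within S D" and "0 < h"
  shows "size {#v \<in># image_mset (\<lambda>p. tent p t) (finite_pairs D). h \<le> v#}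
       = size {#p \<in># finite_pairs D. fst p \<le> t - h \<and> t + h \<le> snd p#}"
proof -
  have "{#p \<in># finite_pairs D. h \<le> tent p t#}
      = {#p \<in># finite_pairs D. fst p \<le> t - h \<and> t + h \<le> snd p#}"
    by (rule filter_mset_cong[OF refl]) (use tent_ge_iff finite_pairs_withinD(2)[OF D] \<open>0 < h\<close> in blast)
  then show ?thesis by (simp add: filter_mset_image_mset)
qed

lemma vr_landscape_shift:
  fixes x y :: "'a::euclidean_space ^ 'n::finite"
  assumes x: "finite_pairs_within S (vr_diagram l x)" and y: "finite_pairs_within S (vr_diagram l y)"
    and m: "1 \<le> m"
  shows "landscape m (vr_diagram l x) t \<le> landscape m (vr_diagram l y) t + 2 * hausdorff_config x y"
  unfolding landscape_eq_nth_largest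
proof (rule nth_largest_shift)
  fix h :: real assume h: "0 < h"
  define \<epsilon> where "\<epsilon> = hausdorff_config x y"
  have \<epsilon>: "0 \<le> \<epsilon>" unfolding \<epsilon>_def by (rule hausdorff_config_nonneg)
  then have h': "0 < h + 2 * \<epsilon>" using h by linarith
  \<comment> \<open>The rectangle for \<open>x\<close> is the one for \<open>y\<close> shrunk by
    \<open>2 * \<epsilon>\<close> in birth and death; \<open>0 < h\<close> provides the strict
    gap.\<close>
  have "size {#p \<in># finite_pairs (vr_diagram l x). fst p \<le> t - (h + 2 * \<epsilon>) \<and> t + (h + 2 * \<epsilon>) \<le> snd p#}
     \<le> size {#p \<in># finite_pairs (vr_diagram l y). fst p \<le> t - h \<and> t + h \<le> snd p#}"
    using vr_count_stability[of "t - (h + 2 * \<epsilon>)" x y "t + (h + 2 * \<epsilon>)" l] h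
    by (simp add: \<epsilon>_def algebra_simps)
  then show "size {#v \<in># image_mset (\<lambda>p. tent p t) (finite_pairs (vr_diagram l x)). h + 2 * hausdorff_config x y \<le> v#}
     \<le> size {#v \<in># image_mset (\<lambda>p. tent p t) (finite_pairs (vr_diagram l y)). h \<le> v#}"
    unfolding size_tent_ge[OF x h', unfolded \<epsilon>_def] size_tent_ge[OF y h] \<epsilon>_def .
qed (use m hausdorff_config_nonneg tent_nonneg in auto)

text \<open>The interval of radius \<open>h + \<bar>t - s\<bar>\<close> around \<open>t\<close>
  contains the one of radius \<open>h\<close> around \<open>s\<close>. This gives continuity, and
  with it integrability.\<close>

lemma landscape_shift_time:
  assumes D: "finite_pairs_within S D" and m: "1 \<le> m"
  shows "landscape m D t \<le> landscape m D s + \<bar>t - s\<bar>"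
  unfolding landscape_eq_nth_largest
proof (rule nth_largest_shift)
  fix h :: real assume h: "0 < h"
  then have h': "0 < h + \<bar>t - s\<bar>" by linarith
  show "size {#v \<in># image_mset (\<lambda>p. tent p t) (finite_pairs D). h + \<bar>t - s\<bar> \<le> v#}
     \<le> size {#v \<in># image_mset (\<lambda>p. tent p s) (finite_pairs D). h \<le> v#}"
    unfolding size_tent_ge[OF D h'] size_tent_ge[OF D h]
    by (rule size_mset_mono, rule filter_mset_mono_strong) auto
qed (use m tent_nonneg in auto)

lemma vr_landscape_sum_stability:
  fixes x y :: "'a::euclidean_space ^ 'n::finite"
  assumes x: "finite_pairs_within S (vr_diagram l x)" and y: "finite_pairs_within S (vr_diagram l y)"
  shows "\<bar>landscape_sum M (vr_diagram l x) t - landscape_sum M (vr_diagram l y) t\<bar>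
       \<le> M * (2 * hausdorff_config x y)"
proof -
  have "\<bar>landscape m (vr_diagram l x) t - landscape m (vr_diagram l y) t\<bar> \<le> 2 * hausdorff_config x y"
    if "m \<in> {1..M}" for m
    using vr_landscape_shift[OF x y, of m t] vr_landscape_shift[OF y x, of m t] that
    by (simp add: hausdorff_config_commute abs_le_iff)
  then have "(\<Sum>m = 1..M. \<bar>landscape m (vr_diagram l x) t - landscape m (vr_diagram l y) t\<bar>)
      \<le> (\<Sum>m = 1..M. 2 * hausdorff_config x y)"
    by (rule sum_mono)
  then show ?thesis
    unfolding landscape_sum_def sum_subtractf[symmetric]
    by (intro order_trans[OF sum_abs]) simp
qed

lemma continuous_on_landscape_sum:
  assumes D: "finite_pairs_within S D"
  shows "continuous_on A (landscape_sum M D)"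
proof -
  have "continuous_on A (landscape m D)" if "m \<in> {1..M}" for m
  proof (rule lipschitz_on_continuous_on)
    show "1-lipschitz_on A (landscape m D)"
    proof (rule lipschitz_onI)
      fix t s
      show "dist (landscape m D t) (landscape m D s) \<le> 1 * dist t s"
        using landscape_shift_time[OF D, of m t s] landscape_shift_time[OF D, of m s t] that
        by (auto simp: dist_real_def abs_le_iff abs_minus_commute)
    qed simp
  qed
  then show ?thesis
    unfolding landscape_sum_def[abs_def] by (intro continuous_on_sum) auto
qed

lemma landscape_sum_nonneg: "0 \<le> landscape_sum M D t"
  unfolding landscape_sum_def landscape_eq_nth_largest
  by (intro sum_nonneg nth_largest_nonneg) (auto simp: tent_nonneg)

text \<open>Every pair lies between 0 and \<open>S\<close>, so every tent lies below the tent of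
  \<open>(0, S)\<close>.\<close>

lemma landscape_sum_le:
  assumes D: "finite_pairs_within S D" and t: "t \<in> {0..S}"
  shows "landscape_sum M D t \<le> M * min t (S - t)"
proof -
  have "tent p t \<le> min t (S - t)" if "p \<in># finite_pairs D" for p
    using finite_pairs_withinD[OF D that] t
    by (auto simp: tent_def field_simps split: prod.splits)
  then have "landscape m D t \<le> min t (S - t)" if "m \<in> {1..M}" for m
    unfolding landscape_eq_nth_largest using that t by (intro nth_largest_le) auto
  then have "landscape_sum M D t \<le> (\<Sum>m = 1..M. min t (S - t))"
    unfolding landscape_sum_def by (rule sum_mono)
  then show ?thesis by simp
qed

subsection \<open>Jensen--Shannon divergence\<close>

lemma abs_sqrt_diff_le:
  assumes "0 \<le> a" "0 \<le> b"
  shows "\<bar>sqrt a - sqrt b\<bar> \<le> sqrt \<bar>a - b\<bar>"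
proof -
  have *: "sqrt u - sqrt v \<le> sqrt \<bar>u - v\<bar>" if "0 \<le> u" "0 \<le> v" for u v
  proof -
    have "sqrt u \<le> sqrt (v + \<bar>u - v\<bar>)" by simp
    also have "\<dots> \<le> sqrt v + sqrt \<bar>u - v\<bar>" using that by (intro sqrt_add_le_add_sqrt) auto
    finally show ?thesis by simp
  qed
  show ?thesis
    using *[OF assms] *[OF assms(2,1)] by (simp add: abs_le_iff abs_minus_commute)
qed

text \<open>The denominator combines the weight 1/2 with the change from base 2 to natural
  logarithms.\<close>

definition js_integrand :: "real \<Rightarrow> real \<Rightarrow> real" where
  "js_integrand a b = (a * ln (a / ((a + b) / 2)) + b * ln (b / ((a + b) / 2))) / (2 * ln 2)"

text \<open>Each summand satisfies \<open>x - m \<le> x * ln (x / m)\<close>, and the lower bounds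
  add up to 0 because \<open>m\<close> is the mean.\<close>

lemma js_integrand_nonneg:
  assumes "0 < a" "0 < b"
  shows "0 \<le> js_integrand a b"
proof -
  define m where "m = (a + b) / 2"
  have m: "0 < m" using assms by (simp add: m_def)
  have *: "x - m \<le> x * ln (x / m)" if "0 < x" for x
  proof -
    have "ln (m / x) \<le> m / x - 1" using that m by (intro ln_le_minus_one) simp
    then have "1 - m / x \<le> ln (x / m)" using that m by (simp add: ln_div)
    from mult_left_mono[OF this, of x] that show ?thesis by (simp add: algebra_simps)
  qed
  have "0 \<le> a * ln (a / m) + b * ln (b / m)"
    using *[OF assms(1)] *[OF assms(2)] by (simp add: m_def field_simps)
  then show ?thesis unfolding js_integrand_def m_def by simp
qed

text \<open>The integrand is convex and \<open>ln (a / m) / (2 * ln 2)\<close>, \<open>ln (b / m) / (2 * ln 2)\<close> are its partial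
  derivatives, so this is the tangent inequality at \<open>(a, b)\<close>.\<close>

lemma js_integrand_tangent:
  assumes "0 < a" "0 < b" "0 < a'" "0 < b'"
  shows "js_integrand a b - js_integrand a' b'
       \<le> ((a - a') * ln (a / ((a + b) / 2)) + (b - b') * ln (b / ((a + b) / 2))) / (2 * ln 2)"
proof -
  define m m' where "m = (a + b) / 2" and "m' = (a' + b') / 2"
  have m: "0 < m" "0 < m'" using assms by (simp_all add: m_def m'_def)
  have *: "x' * (ln (x / m) - ln (x' / m')) \<le> x * m' / m - x'" if "0 < x" "0 < x'" for x x'
  proof -
    \<comment> \<open>This is the inequality \<open>ln s \<le> s - 1\<close> at the quotient of the
      two ratios.\<close>
    have "ln (x * m' / (m * x')) \<le> x * m' / (m * x') - 1"
      using that m by (intro ln_le_minus_one) simp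
    then have "ln (x / m) - ln (x' / m') \<le> x * m' / (m * x') - 1"
      using that m by (simp add: ln_div ln_mult)
    then have "x' * (ln (x / m) - ln (x' / m')) \<le> x' * (x * m' / (m * x') - 1)"
      using that by (intro mult_left_mono) auto
    also have "\<dots> = x * m' / m - x'" using that m by (simp add: right_diff_distrib)
    finally show ?thesis .
  qed
  have "a' * (ln (a / m) - ln (a' / m')) + b' * (ln (b / m) - ln (b' / m'))
      \<le> (a + b) * m' / m - (a' + b')"
    using *[OF assms(1,3)] *[OF assms(2,4)] by (simp add: add_divide_distrib algebra_simps)
  also have "\<dots> = 0" using m assms by (simp add: m_def m'_def)
  finally have "(a * ln (a / m) + b * ln (b / m)) - (a' * ln (a' / m') + b' * ln (b' / m'))
      \<le> (a - a') * ln (a / m) + (b - b') * ln (b / m)"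
    by (simp add: algebra_simps)
  then show ?thesis
    unfolding js_integrand_def m_def[symmetric] m'_def[symmetric] diff_divide_distrib[symmetric]
    by (rule divide_right_mono) simp
qed

text \<open>The crude bound \<open>ln s \<le> s\<close> produces the quotient \<open>hi / lo\<close>
  from which \<open>C_phi\<close> is formed.\<close>

lemma abs_ln_ratio_le:
  fixes lo hi a m :: real
  assumes "0 < lo" "a \<in> {lo..hi}" "m \<in> {lo..hi}"
  shows "\<bar>ln (a / m)\<bar> \<le> hi / lo"
proof -
  have *: "ln (x / y) \<le> hi / lo" if "x \<in> {lo..hi}" "y \<in> {lo..hi}" for x y
  proof -
    have "0 < x / y" using assms(1) that by (intro divide_pos_pos) auto
    then have "ln (x / y) \<le> x / y - 1" by (rule ln_le_minus_one)
    also have "\<dots> \<le> x / y" by simp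
    also have "\<dots> \<le> hi / lo" using assms that by (intro frac_le) auto
    finally show ?thesis .
  qed
  have "- ln (a / m) = ln (m / a)" using assms by (simp add: ln_div)
  then show ?thesis using *[OF assms(2,3)] *[OF assms(3,2)] by (simp add: abs_le_iff)
qed

text \<open>The tangent inequalities at the two points bound the difference from both sides; the
  mean stays in the range, so the slopes are bounded.\<close>

lemma js_integrand_lipschitz:
  assumes lo: "0 < lo" and in_range: "a \<in> {lo..hi}" "b \<in> {lo..hi}" "a' \<in> {lo..hi}" "b' \<in> {lo..hi}"
  shows "\<bar>js_integrand a b - js_integrand a' b'\<bar> \<le> (\<bar>a - a'\<bar> + \<bar>b - b'\<bar>) * (hi / lo) / (2 * ln 2)"
proof -
  have *: "js_integrand u v - js_integrand u' v' \<le> (\<bar>u - u'\<bar> + \<bar>v - v'\<bar>) * (hi / lo) / (2 * ln 2)"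
    if r: "u \<in> {lo..hi}" "v \<in> {lo..hi}" "u' \<in> {lo..hi}" "v' \<in> {lo..hi}" for u v u' v'
  proof -
    have m: "(u + v) / 2 \<in> {lo..hi}" using r by auto
    have le: "x * y \<le> \<bar>x\<bar> * (hi / lo)" if "\<bar>y\<bar> \<le> hi / lo" for x y :: real
      using mult_left_mono[OF that, of "\<bar>x\<bar>"] abs_ge_self[of "x * y"] by (simp add: abs_mult)
    have "(u - u') * ln (u / ((u + v) / 2)) + (v - v') * ln (v / ((u + v) / 2))
        \<le> \<bar>u - u'\<bar> * (hi / lo) + \<bar>v - v'\<bar> * (hi / lo)"
      by (intro add_mono le abs_ln_ratio_le[OF lo _ m] r)
    then have "((u - u') * ln (u / ((u + v) / 2)) + (v - v') * ln (v / ((u + v) / 2))) / (2 * ln 2)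
        \<le> (\<bar>u - u'\<bar> + \<bar>v - v'\<bar>) * (hi / lo) / (2 * ln 2)"
      unfolding distrib_right by (rule divide_right_mono) simp
    moreover have "0 < u" "0 < v" "0 < u'" "0 < v'" using r lo by auto
    ultimately show ?thesis using js_integrand_tangent[of u v u' v'] by linarith
  qed
  show ?thesis
    using *[OF in_range] *[OF in_range(3,4,1,2)] by (simp add: abs_le_iff abs_minus_commute)
qed

lemma continuous_on_js_integrand:
  fixes p q :: "real \<Rightarrow> real"
  assumes "continuous_on A p" "continuous_on A q"
    and "\<And>t. t \<in> A \<Longrightarrow> 0 < p t" "\<And>t. t \<in> A \<Longrightarrow> 0 < q t"
  shows "continuous_on A (\<lambda>t. js_integrand (p t) (q t))"
proof -
  have "p t + q t \<noteq> 0" "p t / ((p t + q t) / 2) \<noteq> 0" "q t / ((p t + q t) / 2) \<noteq> 0" if "t \<in> A" for t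
    using assms(3,4)[OF that] by auto
  then show ?thesis
    unfolding js_integrand_def by (intro continuous_intros assms(1,2)) auto
qed

lemma js_divergence_eq:
  fixes p q :: "real \<Rightarrow> real"
  assumes p: "continuous_on {0..S} p" and q: "continuous_on {0..S} q"
    and pos: "\<And>t. t \<in> {0..S} \<Longrightarrow> 0 < p t" "\<And>t. t \<in> {0..S} \<Longrightarrow> 0 < q t"
  shows "js_divergence S p q = integral {0..S} (\<lambda>t. js_integrand (p t) (q t))"
proof -
  have int: "(\<lambda>t. r t * log 2 (r t / ((p t + q t) / 2))) integrable_on {0..S}"
    if r: "continuous_on {0..S} r" "\<And>t. t \<in> {0..S} \<Longrightarrow> 0 < r t" for r
  proof (rule integrable_continuous_interval)
    have "p t + q t \<noteq> 0" "r t / ((p t + q t) / 2) \<noteq> 0" if "t \<in> {0..S}" for t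
      using pos[OF that] r(2)[OF that] by auto
    then show "continuous_on {0..S} (\<lambda>t. r t * log 2 (r t / ((p t + q t) / 2)))"
      unfolding log_def by (intro continuous_intros p q r(1)) auto
  qed
  have "js_divergence S p q = integral {0..S} (\<lambda>t. 1 / 2 * (p t * log 2 (p t / ((p t + q t) / 2)))
      + 1 / 2 * (q t * log 2 (q t / ((p t + q t) / 2))))"
    unfolding js_divergence_def Let_def
    using int[OF p pos(1)] int[OF q pos(2)]
    by (subst integral_add) (auto intro!: integrable_on_mult_right)
  then show ?thesis
    by (simp add: js_integrand_def log_def field_simps)
qed

lemma js_distance_diff_le:
  fixes p q p' q' :: "real \<Rightarrow> real"
  assumes S: "0 < S" and lo: "0 < lo"
    and cont: "continuous_on {0..S} p" "continuous_on {0..S} q"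
      "continuous_on {0..S} p'" "continuous_on {0..S} q'"
    and in_range: "\<And>t. t \<in> {0..S} \<Longrightarrow> p t \<in> {lo..hi}" "\<And>t. t \<in> {0..S} \<Longrightarrow> q t \<in> {lo..hi}"
      "\<And>t. t \<in> {0..S} \<Longrightarrow> p' t \<in> {lo..hi}" "\<And>t. t \<in> {0..S} \<Longrightarrow> q' t \<in> {lo..hi}"
    and close: "\<And>t. t \<in> {0..S} \<Longrightarrow> \<bar>p t - p' t\<bar> \<le> \<alpha>" "\<And>t. t \<in> {0..S} \<Longrightarrow> \<bar>q t - q' t\<bar> \<le> \<beta>"
  shows "\<bar>js_distance S p q - js_distance S p' q'\<bar> \<le> sqrt (S * ((\<alpha> + \<beta>) * (hi / lo) / (2 * ln 2)))"
proof -
  let ?K = "(\<alpha> + \<beta>) * (hi / lo) / (2 * ln 2)"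
  define f where "f t = js_integrand (p t) (q t)" for t
  define f' where "f' t = js_integrand (p' t) (q' t)" for t
  have pos: "0 < p t" "0 < q t" "0 < p' t" "0 < q' t" if "t \<in> {0..S}" for t
    using in_range[OF that] lo by auto
  have f: "continuous_on {0..S} f" "continuous_on {0..S} f'"
    unfolding f_def f'_def by (rule continuous_on_js_integrand; fact cont pos | fact)+
  have js: "js_divergence S p q = integral {0..S} f" "js_divergence S p' q' = integral {0..S} f'"
    unfolding f_def f'_def by (rule js_divergence_eq; fact cont pos)+
  \<comment> \<open>Nonnegative divergences are required for the estimate of the difference of
    square roots.\<close>
  have nonneg: "0 \<le> integral {0..S} f" "0 \<le> integral {0..S} f'"
    unfolding f_def f'_def using pos
    by (auto intro!: integral_nonneg integrable_continuous_interval js_integrand_nonneg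
        f[unfolded f_def f'_def])
  have "norm (f t - f' t) \<le> ?K" if "t \<in> {0..S}" for t
  proof -
    have "\<bar>f t - f' t\<bar> \<le> (\<bar>p t - p' t\<bar> + \<bar>q t - q' t\<bar>) * (hi / lo) / (2 * ln 2)"
      unfolding f_def f'_def by (rule js_integrand_lipschitz[OF lo in_range[OF that]])
    also have "\<dots> \<le> ?K"
    proof -
      have "0 \<le> hi / lo" using in_range(1)[OF that] lo by auto
      then show ?thesis
        by (intro divide_right_mono mult_right_mono add_mono close[OF that]) auto
    qed
    finally show ?thesis by simp
  qed
  then have "norm (integral {0..S} (\<lambda>t. f t - f' t)) \<le> ?K * (S - 0)"
    using S f by (intro integral_bound continuous_on_diff) auto
  moreover have "integral {0..S} (\<lambda>t. f t - f' t) = integral {0..S} f - integral {0..S} f'"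
    using f by (intro integral_diff integrable_continuous_interval)
  ultimately have "\<bar>integral {0..S} f - integral {0..S} f'\<bar> \<le> S * ?K"
    by (simp add: mult.commute)
  then show ?thesis
    unfolding js_distance_def js
    using abs_sqrt_diff_le[OF nonneg] real_sqrt_le_mono order_trans by blast
qed

subsection \<open>Landscape densities\<close>

text \<open>\<open>max_area\<close> is \<open>M\<close> times the area of this triangle.\<close>

lemma integral_triangle:
  assumes "0 \<le> S"
  shows "((\<lambda>t. min t (S - t)) has_integral S\<^sup>2 / 4) {0..S :: real}"
proof -
  have "((\<lambda>t. t) has_integral ((S / 2)\<^sup>2 - 0\<^sup>2) / 2) {0..S / 2}"
    using assms by (intro ident_has_integral) simp
  then have 1: "((\<lambda>t. min t (S - t)) has_integral ((S / 2)\<^sup>2 - 0\<^sup>2) / 2) {0..S / 2}"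
    by (rule has_integral_eq[rotated]) auto
  have "((\<lambda>t. S - t) has_integral (S - S / 2) *\<^sub>R S - (S\<^sup>2 - (S / 2)\<^sup>2) / 2) {S / 2..S}"
    using assms by (intro has_integral_diff has_integral_const_real ident_has_integral
        has_integral_const_real[THEN has_integral_eq_rhs]) (auto simp: algebra_simps)
  then have 2: "((\<lambda>t. min t (S - t)) has_integral (S - S / 2) *\<^sub>R S - (S\<^sup>2 - (S / 2)\<^sup>2) / 2) {S / 2..S}"
    by (rule has_integral_eq[rotated]) auto
  have eq: "((S / 2)\<^sup>2 - 0\<^sup>2) / 2 + ((S - S / 2) *\<^sub>R S - (S\<^sup>2 - (S / 2)\<^sup>2) / 2) = S\<^sup>2 / 4"
    by (simp add: power2_eq_square field_simps)
  have "0 \<le> S / 2" "S / 2 \<le> S" using assms by auto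
  from has_integral_combine[OF this 1 2] show ?thesis unfolding eq .
qed

lemma landscape_area_bounds:
  assumes D: "finite_pairs_within S D" and S: "0 < S"
  shows "0 \<le> landscape_area M S D" "landscape_area M S D \<le> max_area M S"
proof -
  have int: "landscape_sum M D integrable_on {0..S}"
    by (rule integrable_continuous_interval[OF continuous_on_landscape_sum[OF D]])
  show "0 \<le> landscape_area M S D"
    unfolding landscape_area_def by (rule integral_nonneg[OF int]) (rule landscape_sum_nonneg)
  have "((\<lambda>t. M * min t (S - t)) has_integral M * (S\<^sup>2 / 4)) {0..S}"
    using S by (intro has_integral_mult_right integral_triangle) simp
  with integrable_integral[OF int] have "integral {0..S} (landscape_sum M D) \<le> M * (S\<^sup>2 / 4)"
    by (rule has_integral_le) (rule landscape_sum_le[OF D])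
  then show "landscape_area M S D \<le> max_area M S"
    by (simp add: landscape_area_def max_area_def)
qed

lemma landscape_area_diff_le:
  assumes D: "finite_pairs_within S D" and D': "finite_pairs_within S D'" and S: "0 < S"
    and close: "\<And>t. \<bar>landscape_sum M D t - landscape_sum M D' t\<bar> \<le> \<eta>"
  shows "\<bar>landscape_area M S D - landscape_area M S D'\<bar> \<le> S * \<eta>"
proof -
  note cont = continuous_on_landscape_sum[OF D, of "{0..S}" M]
    continuous_on_landscape_sum[OF D', of "{0..S}" M]
  have "norm (integral {0..S} (\<lambda>t. landscape_sum M D t - landscape_sum M D' t)) \<le> \<eta> * (S - 0)"
    using S close by (intro integral_bound continuous_on_diff cont) auto
  moreover have "integral {0..S} (\<lambda>t. landscape_sum M D t - landscape_sum M D' t)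
      = landscape_area M S D - landscape_area M S D'"
    unfolding landscape_area_def by (intro integral_diff integrable_continuous_interval cont)
  ultimately show ?thesis by (simp add: mult.commute)
qed

context
  fixes M :: nat and S \<gamma> \<theta> :: real
  assumes M: "1 \<le> M" and S: "0 < S" and \<gamma>: "0 \<le> \<gamma>" "\<gamma> \<le> 1" and \<theta>: "0 < \<theta>" "\<theta> \<le> 1"
begin

text \<open>This is the value of the density formula at landscape sum 0 and maximal area.\<close>

definition density_floor :: real where
  "density_floor = (\<gamma> + \<theta>) / (S * (1 + \<theta>))"

text \<open>This is the value of the density formula at landscape sum \<open>M * S / 2\<close>, the
  peak height, and area 0.\<close>

definition density_ceiling :: real where
  "density_ceiling = (1 + 2 * (1 - \<gamma>) / \<theta>) / S"

private definition mass :: real where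
  "mass = \<theta> * max_area M S"

private lemma mass_eq: "mass = \<theta> * M * S\<^sup>2 / 4"
  by (simp add: mass_def max_area_def)

private lemma mass_pos: "0 < mass"
  using M S \<theta> by (simp add: mass_eq)

lemma density_floor_pos: "0 < density_floor"
  using S \<theta> \<gamma> by (simp add: density_floor_def)

text \<open>This is where \<open>C_phi\<close> comes from: the quotient of the extreme densities,
  with \<open>ln 2\<close> from the base of the logarithm.\<close>

lemma density_ratio: "density_ceiling / density_floor / ln 2 = C_phi \<gamma> \<theta>"
proof -
  have "E / S / ((\<gamma> + \<theta>) / (S * (1 + \<theta>))) / ln 2 = (1 + \<theta>) / ((\<gamma> + \<theta>) * ln 2) * E" for E
    using S \<theta> \<gamma> by simp
  then show ?thesis
    unfolding density_floor_def density_ceiling_def C_phi_def .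
qed

private lemma pl_density_eq:
  "t \<in> {0..S} \<Longrightarrow> pl_density M S \<gamma> \<theta> D t
     = (1 - \<gamma>) * ((landscape_sum M D t + mass / S) / (landscape_area M S D + mass)) + \<gamma> / S"
  by (simp add: pl_density_def mass_def uniform_density_def)

private lemma landscape_sum_le_half:
  assumes D: "finite_pairs_within S D" and t: "t \<in> {0..S}"
  shows "landscape_sum M D t \<le> M * S / 2"
proof -
  have "min t (S - t) \<le> S / 2" by linarith
  then have "M * min t (S - t) \<le> M * (S / 2)" by (intro mult_left_mono) auto
  with landscape_sum_le[OF D t, of M] show ?thesis by simp
qed

lemma pl_density_bounds:
  assumes D: "finite_pairs_within S D" and t: "t \<in> {0..S}"
  shows "pl_density M S \<gamma> \<theta> D t \<in> {density_floor..density_ceiling}"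
proof -
  define L where "L = landscape_sum M D t"
  define A where "A = landscape_area M S D"
  have L: "0 \<le> L" "L \<le> M * S / 2"
    unfolding L_def using landscape_sum_nonneg landscape_sum_le_half[OF D t] by auto
  have A: "0 \<le> A" "A \<le> max_area M S"
    unfolding A_def using landscape_area_bounds[OF D S] by auto
  have max_area: "max_area M S = mass / \<theta>" using \<theta> by (simp add: mass_def)
  have "(mass / S) / (mass / \<theta> + mass) \<le> (L + mass / S) / (A + mass)"
    using L A mass_pos S by (intro frac_le) (auto simp: max_area)
  moreover have "(mass / S) / (mass / \<theta> + mass) = \<theta> / (S * (1 + \<theta>))"
  proof -
    have "mass / \<theta> + mass = mass * (1 + \<theta>) / \<theta>" using \<theta> by (simp add: field_simps)
    then show ?thesis using mass_pos by simp
  qed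
  ultimately have "(1 - \<gamma>) * (\<theta> / (S * (1 + \<theta>))) \<le> (1 - \<gamma>) * ((L + mass / S) / (A + mass))"
    using \<gamma> by (intro mult_left_mono) auto
  moreover have "(1 - \<gamma>) * (\<theta> / (S * (1 + \<theta>))) + \<gamma> / S = density_floor"
    using S \<theta> by (simp add: density_floor_def divide_simps) (simp add: algebra_simps)
  ultimately have 1: "density_floor \<le> pl_density M S \<gamma> \<theta> D t"
    unfolding pl_density_eq[OF t] L_def A_def by linarith
  have "(L + mass / S) / (A + mass) \<le> (M * S / 2 + mass / S) / mass"
    using L A mass_pos S by (intro frac_le) auto
  also have "\<dots> = (2 / \<theta> + 1) / S"
    using S \<theta> M by (simp add: mass_eq power2_eq_square field_simps)
  finally have "(1 - \<gamma>) * ((L + mass / S) / (A + mass)) \<le> (1 - \<gamma>) * ((2 / \<theta> + 1) / S)"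
    using \<gamma> by (intro mult_left_mono) auto
  moreover have "(1 - \<gamma>) * ((2 / \<theta> + 1) / S) + \<gamma> / S = density_ceiling"
    using S \<theta> by (simp add: density_ceiling_def field_simps)
  ultimately have 2: "pl_density M S \<gamma> \<theta> D t \<le> density_ceiling"
    unfolding pl_density_eq[OF t] L_def A_def by linarith
  from 1 2 show ?thesis by simp
qed

lemma continuous_on_pl_density:
  assumes D: "finite_pairs_within S D"
  shows "continuous_on {0..S} (pl_density M S \<gamma> \<theta> D)"
proof -
  have "landscape_area M S D + mass \<noteq> 0"
    using landscape_area_bounds(1)[OF D S, of M] mass_pos by linarith
  then have "continuous_on {0..S} (\<lambda>t. (1 - \<gamma>) *
      ((landscape_sum M D t + mass / S) / (landscape_area M S D + mass)) + \<gamma> / S)"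
    by (intro continuous_intros continuous_on_landscape_sum[OF D]) auto
  then show ?thesis
    by (rule continuous_on_eq) (rule pl_density_eq[symmetric])
qed

lemma pl_density_diff_le:
  fixes \<delta> :: real
  assumes D: "finite_pairs_within S D" and D': "finite_pairs_within S D'"
    and close: "\<And>t. \<bar>landscape_sum M D t - landscape_sum M D' t\<bar> \<le> M * \<delta>"
    and t: "t \<in> {0..S}"
  shows "\<bar>pl_density M S \<gamma> \<theta> D t - pl_density M S \<gamma> \<theta> D' t\<bar> \<le> C_Density S \<gamma> \<theta> * \<delta>"
proof -
  define x where "x = landscape_sum M D t + mass / S"
  define x' where "x' = landscape_sum M D' t + mass / S"
  define X where "X = landscape_area M S D + mass"
  define X' where "X' = landscape_area M S D' + mass"
  have X: "mass \<le> X" "mass \<le> X'" "0 < X" "0 < X'"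
    using landscape_area_bounds(1)[OF D S, of M] landscape_area_bounds(1)[OF D' S, of M] mass_pos
    by (simp_all add: X_def X'_def)
  have M\<delta>: "0 \<le> M * \<delta>" using close[of 0] by linarith
  have dx: "\<bar>x - x'\<bar> \<le> M * \<delta>" using close[of t] by (simp add: x_def x'_def)
  have dX: "\<bar>X' - X\<bar> \<le> S * (M * \<delta>)"
    using landscape_area_diff_le[OF D D' S close] by (simp add: X_def X'_def abs_minus_commute)
  have x': "0 \<le> x'" "x' \<le> M * S / 2 + mass / S"
    using landscape_sum_nonneg[of M D' t] landscape_sum_le_half[OF D' t] mass_pos S
    by (simp_all add: x'_def)
  \<comment> \<open>The change of the numerator is separated from the change of the normalizing
    area.\<close>
  have "x / X - x' / X' = (x - x') / X + x' * (X' - X) / (X * X')"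
    using X by (simp add: field_simps)
  then have "\<bar>x / X - x' / X'\<bar> \<le> \<bar>x - x'\<bar> / X + x' * \<bar>X' - X\<bar> / (X * X')"
    using X x' abs_triangle_ineq[of "(x - x') / X" "x' * (X' - X) / (X * X')"]
    by (simp add: abs_mult)
  also have "\<dots> \<le> M * \<delta> / mass + (M * S / 2 + mass / S) * (S * (M * \<delta>)) / (mass * mass)"
    using X x' dx dX mass_pos M\<delta> S
    by (intro add_mono frac_le mult_mono) auto
  \<comment> \<open>As \<open>mass\<close> is \<open>\<theta> * M * S\<^sup>2 / 4\<close>, the first
    term gives \<open>4 / \<theta>\<close>, the second
    \<open>4 / \<theta> + 8 / \<theta>\<^sup>2\<close>, and \<open>M\<close> cancels.\<close>
  also have "\<dots> = (8 / \<theta> + 8 / \<theta>\<^sup>2) * \<delta> / S\<^sup>2"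
    using M S \<theta> by (simp add: mass_eq power2_eq_square field_simps)
  finally have "(1 - \<gamma>) * \<bar>x / X - x' / X'\<bar> \<le> (1 - \<gamma>) * ((8 / \<theta> + 8 / \<theta>\<^sup>2) * \<delta> / S\<^sup>2)"
    using \<gamma> by (intro mult_left_mono) auto
  also have "\<dots> = C_Density S \<gamma> \<theta> * \<delta>"
  proof -
    have "8 / \<theta> + 8 / \<theta>\<^sup>2 = 8 * (1 / \<theta> + 1 / \<theta>\<^sup>2)" by (simp add: distrib_left)
    then show ?thesis
      by (simp only: C_Density_def times_divide_eq_left times_divide_eq_right mult_ac)
  qed
  finally have "\<bar>(1 - \<gamma>) * (x / X - x' / X')\<bar> \<le> C_Density S \<gamma> \<theta> * \<delta>"
    using \<gamma> by (simp add: abs_mult)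
  then show ?thesis
    unfolding pl_density_eq[OF t] x_def x'_def X_def X'_def by (simp add: right_diff_distrib)
qed

text \<open>The radicand multiplies the interval length \<open>S\<close>, the Lipschitz constant
  \<open>C_phi / 2\<close> of the integrand and the density change
  \<open>C_Density * (\<delta>1 + \<delta>2)\<close>.\<close>

lemma pljs_stability:
  fixes \<delta>1 \<delta>2 :: real
  assumes D: "finite_pairs_within S D1" "finite_pairs_within S D2"
      "finite_pairs_within S E1" "finite_pairs_within S E2"
    and close: "\<And>t. \<bar>landscape_sum M D1 t - landscape_sum M E1 t\<bar> \<le> M * \<delta>1"
      "\<And>t. \<bar>landscape_sum M D2 t - landscape_sum M E2 t\<bar> \<le> M * \<delta>2"
  shows "\<bar>pljs M S \<gamma> \<theta> D1 D2 - pljs M S \<gamma> \<theta> E1 E2\<bar>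
       \<le> sqrt (S * C_phi \<gamma> \<theta> * C_Density S \<gamma> \<theta> * (\<delta>1 + \<delta>2) / 2)"
proof -
  have "\<bar>pljs M S \<gamma> \<theta> D1 D2 - pljs M S \<gamma> \<theta> E1 E2\<bar>
      \<le> sqrt (S * ((C_Density S \<gamma> \<theta> * \<delta>1 + C_Density S \<gamma> \<theta> * \<delta>2)
          * (density_ceiling / density_floor) / (2 * ln 2)))"
    unfolding pljs_def
    by (rule js_distance_diff_le[OF S density_floor_pos])
      (fact continuous_on_pl_density[OF D(1)] continuous_on_pl_density[OF D(2)]
        continuous_on_pl_density[OF D(3)] continuous_on_pl_density[OF D(4)]
      | rule pl_density_bounds D pl_density_diff_le[OF D(1,3) close(1)]
          pl_density_diff_le[OF D(2,4) close(2)] | assumption)+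
  also have "S * ((C_Density S \<gamma> \<theta> * \<delta>1 + C_Density S \<gamma> \<theta> * \<delta>2)
          * (density_ceiling / density_floor) / (2 * ln 2))
      = S * C_phi \<gamma> \<theta> * C_Density S \<gamma> \<theta> * (\<delta>1 + \<delta>2) / 2"
    unfolding density_ratio[symmetric] using density_floor_pos by (simp add: field_simps)
  finally show ?thesis .
qed

end

section \<open>The Hoelder estimate for two point clouds\<close>

theorem theorem9:
  fixes x1 y1 :: "(real ^ 'd::finite) ^ 'n1::finite"
    and x2 y2 :: "(real ^ 'd) ^ 'n2::finite"
    and M l :: nat
    and S \<gamma> \<theta> :: real
  assumes "M \<ge> 1"
    and "S > 0"
    and "0 \<le> \<gamma>" and "\<gamma> \<le> 1"
    and "0 < \<theta>" and "\<theta> \<le> 1"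
    and "finite_pairs_within S (vr_diagram l x1)"
    and "finite_pairs_within S (vr_diagram l y1)"
    and "finite_pairs_within S (vr_diagram l x2)"
    and "finite_pairs_within S (vr_diagram l y2)"
  shows "\<bar>pljs_vr l M S \<gamma> \<theta> x1 x2 - pljs_vr l M S \<gamma> \<theta> y1 y2\<bar>
           \<le> C_T S \<gamma> \<theta> * sqrt (hausdorff_pair (x1, x2) (y1, y2))"
proof -
  let ?d = "hausdorff_pair (x1, x2) (y1, y2)"
  have d: "0 \<le> ?d"
    by (simp add: hausdorff_pair_def hausdorff_config_nonneg)
  have C: "0 \<le> S * C_phi \<gamma> \<theta> * C_Density S \<gamma> \<theta>"
    using assms(2-6) by (simp add: C_phi_def C_Density_def)
  \<comment> \<open>Landscapes move by at most twice the Hausdorff distance, so each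
    \<open>\<delta>\<close> is twice a distance; this 2 cancels the final division by 2.\<close>
  have "\<bar>pljs_vr l M S \<gamma> \<theta> x1 x2 - pljs_vr l M S \<gamma> \<theta> y1 y2\<bar>
      \<le> sqrt (S * C_phi \<gamma> \<theta> * C_Density S \<gamma> \<theta> *
          (2 * hausdorff_config x1 y1 + 2 * hausdorff_config x2 y2) / 2)"
    unfolding pljs_vr_def
    by (rule pljs_stability[OF assms(1-7,9,8,10)])
      (rule vr_landscape_sum_stability[OF assms(7,8)] vr_landscape_sum_stability[OF assms(9,10)])+
  also have "\<dots> = sqrt (S * C_phi \<gamma> \<theta> * C_Density S \<gamma> \<theta> * ?d)"
  proof -
    have "K * (2 * a + 2 * b) / 2 = K * (a + b)" for K a b :: real
      by (simp add: field_simps)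
    then show ?thesis by (simp add: hausdorff_pair_def)
  qed
  \<comment> \<open>The radicand is nonnegative, so doubling it can only increase the root and
    produces \<open>C_T\<close>.\<close>
  also have "\<dots> \<le> sqrt (2 * S * C_phi \<gamma> \<theta> * C_Density S \<gamma> \<theta> * ?d)"
    using mult_nonneg_nonneg[OF C d] by simp
  also have "\<dots> = C_T S \<gamma> \<theta> * sqrt ?d"
    by (simp add: C_T_def real_sqrt_mult)
  finally show ?thesis .
qed

end
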